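(* Let $(A,\cdot_A,a_A)$ be a left-symmetric algebroid. (1) If $\mathfrak B\in \mathrm{Sym}^2(A^* )$ is a nondegenerate $2$-cocycle that is a complementary symmetric $2$-tensor for a Koszul-Vinberg structure $H$ on $A$, then $(\mathfrak B,N)$, where $N=H^\sharp\circ\mathfrak B^\natural$, is a pseudo-Hessian-Nijenhuis structure on $A$. (2) Conversely, if $(\mathfrak B,N)$ is a pseudo-Hessian-Nijenhuis structure on $A$ with $\mathfrak B$ nondegenerate, then $\mathcal H$ given by $\mathcal H^\sharp=N\circ(\mathfrak B^\natural)^{-1}$ is a Koszul-Vinberg structure on $A$, and $\mathfrak B$ is a $2$-cocycle that is a complementary symmetric $2$-tensor for $\mathcal H$.
   Context: Left-symmetric algebroids. A left-symmetric algebroid $(A,\cdot_A,a_A)$ is a smooth real vector bundle $A\to M$ with an $\mathbb R$-bilinear operation $\cdot_A$ on $\Gamma(A)$ such that $x\cdot_A(y\cdot_A z)-(x\cdot_A y)\cdot_A z$ is symmetric in $x,y$, and a bundle map $a_A:A\to TM$ such that $x\cdot_A(fy)=f(x\cdot_A y)+a_A(x)(f)\,y$ and $(fx)\cdot_A y=f(x\cdot_A y)$ for $x,y\in\Gamma(A)$, $f\in C^\infty(M)$. Put $[x,y]_A=x\cdot_A y-y\cdot_A x$. Nijenhuis operators. A bundle map $N:A\to A$ (over the identity) is a Nijenhuis operator on $A$ if $N(x)\cdot_A N(y)=N\big(x\cdot_A N(y)+N(x)\cdot_A y-N(x\cdot_A y)\big)$ for all $x,y\in\Gamma(A)$. Koszul-Vinberg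 structures. $\mathrm{Sym}^2(A)$ is the set of symmetric sections $H$ of $A\otimes A$; $H^\sharp:A^*\to A$ is $\langle H^\sharp(\alpha),\beta\rangle=H(\alpha,\beta)$. For $\alpha_i\in\Gamma(A^* )$, $$\begin{aligned}[\![ H,H]\!]_A(\alpha_1,\alpha_2,\alpha_3)=\ &a_A(H^\sharp(\alpha_1))\langle H^\sharp(\alpha_2),\alpha_3\rangle-a_A(H^\sharp(\alpha_2))\langle H^\sharp(\alpha_1),\alpha_3\rangle+\langle\alpha_1,H^\sharp(\alpha_2)\cdot_A H^\sharp(\alpha_3)\rangle\\&-\langle\alpha_2,H^\sharp(\alpha_1)\cdot_A H^\sharp(\alpha_3)\rangle-\langle\alpha_3,[H^\sharp(\alpha_1),H^\sharp(\alpha_2)]_A\rangle.\end{aligned}$$ $H$ is a Koszul-Vinberg structure if $[\![ H,H]\!]_A=0$. Product on $\Gamma(A^* )$. With $\langle\mathcal L_x\alpha,y\rangle=a_A(x)\langle\alpha,y\rangle-\langle\alpha,[x,y]_A\rangle$, $\langle R_x\alpha,y\rangle=-\langle\alpha,y\cdot_A x\rangle$, $\langle d_Af,x\rangle=a_A(x)(f)$, set $\alpha\cdot^{H^\sharp}\beta=\mathcal L_{H^\sharp(\alpha)}\beta-R_{H^\sharp(\beta)}\alpha-d_A(H(\alpha,\beta))$. If $H$ is a Koszul-Vinberg structure, $(A^*,\cdot^{H^\sharp},a_{A^*}=a_A\circ H^\sharp)$ is a left-symmetric algebroid (known). Cocycles and pseudo-Hessian structures. $\mathrm{Sym}^2(A^*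 )$ is the set of symmetric sections $\mathfrak B$ of $A^*\otimes A^*$; $\mathfrak B^\natural:A\to A^*$ is $\langle\mathfrak B^\natural(x),y\rangle=\mathfrak B(x,y)$; $\mathfrak B$ is nondegenerate if $\mathfrak B^\natural$ is invertible. $\delta_A\mathfrak B(x,y,z)=a_A(x)\mathfrak B(y,z)-a_A(y)\mathfrak B(x,z)-\mathfrak B(y,x\cdot_A z)+\mathfrak B(x,y\cdot_A z)-\mathfrak B([x,y]_A,z)$; $\mathfrak B$ is a $2$-cocycle, equivalently a pseudo-Hessian structure on $A$, if $\delta_A\mathfrak B=0$. Complementary symmetric $2$-tensor for a Koszul-Vinberg structure $H$: an element $\mathfrak B\in \mathrm{Sym}^2(A^* )$ with $[\![\mathfrak B,\mathfrak B]\!]_{A^*}=0$, where, for $x_1,x_2,x_3\in\Gamma(A)$, $$\begin{aligned}[\![\mathfrak B,\mathfrak B]\!]_{A^*}(x_1,x_2,x_3)=\ &a_A(H^\sharp\mathfrak B^\natural(x_1))\langle\mathfrak B^\natural(x_2),x_3\rangle-a_A(H^\sharp\mathfrak B^\natural(x_2))\langle\mathfrak B^\natural(x_1),x_3\rangle+\langle x_1,\mathfrak B^\natural(x_2)\cdot^{H^\sharp}\mathfrak B^\natural(x_3)\rangle\\&-\langle x_2,\mathfrak B^\natural(x_1)\cdot^{H^\sharp}\mathfrak B^\natural(x_3)\rangle-\langle x_3,\mathfrak B^\natural(x_1)\cdot^{H^\sharp}\mathfrak B^\natural(x_2)-\mathfrak B^\natural(x_2)\cdot^{H^\sharp}\mathfrak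 B^\natural(x_1)\rangle,\end{aligned}$$ i.e. the formula defining $[\![ H,H]\!]_A$, applied to the left-symmetric algebroid $(A^*,\cdot^{H^\sharp},a_A\circ H^\sharp)$ and $\mathfrak B$ (identifying $A^{**}=A$, with $\mathfrak B^\natural$ in the role of $H^\sharp$). Pseudo-Hessian-Nijenhuis (HN) structure: a pair $(\mathfrak B,N)$ with $\mathfrak B$ a pseudo-Hessian structure and $N$ a Nijenhuis operator on $A$ such that $\mathfrak B(N(x),y)=\mathfrak B(x,N(y))$ for all $x,y\in\Gamma(A)$ and $\delta_A\mathfrak B_N=0$, where $\mathfrak B_N(x,y)=\mathfrak B(N(x),y)$. *)

theory Defs
  imports "HOL-Analysis.Analysis"
begin

section \<open>Smooth manifolds\<close>

text \<open>Smoothness is only used on open sets of finite-dimensional spaces, where it suffices to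
  iterate directional derivatives of a Frechet differentiable map.\<close>

primrec times_differentiable_on ::
    "nat \<Rightarrow> 'a::real_normed_vector set \<Rightarrow> ('a \<Rightarrow> 'b::real_normed_vector) \<Rightarrow> bool" where
  "times_differentiable_on 0 S f \<longleftrightarrow> continuous_on S f"
| "times_differentiable_on (Suc k) S f \<longleftrightarrow>
     (\<forall>x\<in>S. f differentiable (at x)) \<and>
     (\<forall>v. times_differentiable_on k S (\<lambda>x. frechet_derivative f (at x) v))"

definition smooth_on :: "'a::real_normed_vector set \<Rightarrow> ('a \<Rightarrow> 'b::real_normed_vector) \<Rightarrow> bool" where
  "smooth_on S f \<longleftrightarrow> (\<forall>k. times_differentiable_on k S f)"

text \<open>The manifold is the whole type \<open>'m\<close>. Its charts take values in a finite-dimensional inner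
  product space \<open>'e\<close>; the class \<open>euclidean_space\<close> is avoided because it excludes dimension 0.\<close>

definition smooth_atlas ::
    "('m::{t2_space,second_countable_topology} set \<times> ('m \<Rightarrow> 'e::real_inner)) set \<Rightarrow> bool" where
  "smooth_atlas C \<longleftrightarrow>
     (\<exists>S::'e set. finite S \<and> span S = UNIV) \<and>
     (\<forall>(U, \<psi>)\<in>C. open U \<and> open (\<psi> ` U) \<and> homeomorphism U (\<psi> ` U) \<psi> (inv_into U \<psi>)) \<and>
     (\<Union>(U, \<psi>)\<in>C. U) = UNIV \<and>
     (\<forall>(U, \<psi>)\<in>C. \<forall>(U', \<psi>')\<in>C. smooth_on (\<psi> ` (U \<inter> U')) (\<psi>' \<circ> inv_into U \<psi>))"

definition smooth_fun_on ::
    "('m set \<times> ('m \<Rightarrow> 'e::real_inner)) set \<Rightarrow> 'm set \<Rightarrow> ('m \<Rightarrow> real) \<Rightarrow> bool" where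
  "smooth_fun_on C W f \<longleftrightarrow> (\<forall>(U, \<psi>)\<in>C. smooth_on (\<psi> ` (U \<inter> W)) (f \<circ> inv_into U \<psi>))"

section \<open>Vector bundles and their sections\<close>

text \<open>The fibre over \<open>p\<close> is a subspace \<open>fibre A p\<close> of a real vector space \<open>'f\<close> which carries no
  topology. This is no restriction: any family of vector spaces embeds into its direct sum. In
  particular the inclusion of the fibres into \<open>'f\<close> has nothing to do with the smooth structure,
  which is given by the local trivialisations \<open>(U, r, \<phi>)\<close>: for \<open>q \<in> U\<close>, \<open>\<phi> q\<close> is a linear
  isomorphism of the fibre over \<open>q\<close> onto \<open>\<real>\<^sup>r\<close>, encoded as the set of functions \<open>c :: nat \<Rightarrow> real\<close>
  with \<open>c i = 0\<close> for \<open>i \<ge> r\<close>.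

  \<open>mul\<close> is relevant on smooth sections only, and \<open>anchor A p v\<close> is a tangent vector at \<open>p\<close>, that
  is, a derivation at \<open>p\<close> of the algebra of smooth functions.\<close>

record ('m, 'e, 'f) algebroid =
  charts :: "('m set \<times> ('m \<Rightarrow> 'e)) set"
  fibre :: "'m \<Rightarrow> 'f set"
  trivs :: "('m set \<times> nat \<times> ('m \<Rightarrow> 'f \<Rightarrow> nat \<Rightarrow> real)) set"
  mul :: "('m \<Rightarrow> 'f) \<Rightarrow> ('m \<Rightarrow> 'f) \<Rightarrow> ('m \<Rightarrow> 'f)"
  anchor :: "'m \<Rightarrow> 'f \<Rightarrow> ('m \<Rightarrow> real) \<Rightarrow> real"

text \<open>The \<open>j\<close>-th vector at \<open>q\<close> of the local frame belonging to the trivialisation \<open>\<phi>\<close>.\<close>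

definition frame ::
    "('m, 'e, 'f) algebroid \<Rightarrow> ('m \<Rightarrow> 'f \<Rightarrow> nat \<Rightarrow> real) \<Rightarrow> nat \<Rightarrow> 'm \<Rightarrow> 'f" where
  "frame A \<phi> j q = inv_into (fibre A q) (\<phi> q) (\<lambda>i. if i = j then 1 else 0)"

definition smooth_vector_bundle ::
    "('m::{t2_space,second_countable_topology}, 'e::real_inner, 'f::real_vector) algebroid \<Rightarrow> bool"
  where
  "smooth_vector_bundle A \<longleftrightarrow>
     smooth_atlas (charts A) \<and>
     (\<forall>p. subspace (fibre A p)) \<and>
     (\<Union>(U, r, \<phi>)\<in>trivs A. U) = UNIV \<and>
     (\<forall>(U, r, \<phi>)\<in>trivs A. open U \<and>
        (\<forall>q\<in>U. bij_betw (\<phi> q) (fibre A q) {c. \<forall>i\<ge>r. c i = 0} \<and>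
          (\<forall>v\<in>fibre A q. \<forall>w\<in>fibre A q. \<forall>i. \<phi> q (v + w) i = \<phi> q v i + \<phi> q w i) \<and>
          (\<forall>v\<in>fibre A q. \<forall>c i. \<phi> q (c *\<^sub>R v) i = c * \<phi> q v i))) \<and>
     (\<forall>(U, r, \<phi>)\<in>trivs A. \<forall>(U', r', \<phi>')\<in>trivs A. \<forall>j<r. \<forall>i<r'.
        smooth_fun_on (charts A) (U \<inter> U') (\<lambda>q. \<phi>' q (frame A \<phi> j q) i))"

definition smooth_functions :: "('m, 'e::real_inner, 'f) algebroid \<Rightarrow> ('m \<Rightarrow> real) set" where
  "smooth_functions A = {f. smooth_fun_on (charts A) UNIV f}"

definition sections :: "('m, 'e::real_inner, 'f) algebroid \<Rightarrow> ('m \<Rightarrow> 'f) set" where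
  "sections A = {s. (\<forall>p. s p \<in> fibre A p) \<and>
     (\<forall>(U, r, \<phi>)\<in>trivs A. \<forall>i<r. smooth_fun_on (charts A) U (\<lambda>q. \<phi> q (s q) i))}"

text \<open>Covectors are extended by 0 outside the fibre, so that they are determined by their
  values on it.\<close>

definition dual_fibre :: "('m, 'e, 'f::real_vector) algebroid \<Rightarrow> 'm \<Rightarrow> ('f \<Rightarrow> real) set" where
  "dual_fibre A p = {\<theta>.
     (\<forall>v\<in>fibre A p. \<forall>w\<in>fibre A p. \<theta> (v + w) = \<theta> v + \<theta> w) \<and>
     (\<forall>v\<in>fibre A p. \<forall>c. \<theta> (c *\<^sub>R v) = c * \<theta> v) \<and>
     (\<forall>v. v \<notin> fibre A p \<longrightarrow> \<theta> v = 0)}"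

definition dual_sections ::
    "('m, 'e::real_inner, 'f::real_vector) algebroid \<Rightarrow> ('m \<Rightarrow> 'f \<Rightarrow> real) set" where
  "dual_sections A = {\<alpha>. (\<forall>p. \<alpha> p \<in> dual_fibre A p) \<and>
     (\<forall>(U, r, \<phi>)\<in>trivs A. \<forall>j<r. smooth_fun_on (charts A) U (\<lambda>q. \<alpha> q (frame A \<phi> j q)))}"

definition pair :: "('m \<Rightarrow> 'f \<Rightarrow> real) \<Rightarrow> ('m \<Rightarrow> 'f) \<Rightarrow> 'm \<Rightarrow> real" where
  "pair \<alpha> x = (\<lambda>p. \<alpha> p (x p))"

definition app :: "('m \<Rightarrow> 'a \<Rightarrow> 'b) \<Rightarrow> ('m \<Rightarrow> 'a) \<Rightarrow> 'm \<Rightarrow> 'b" where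
  "app T s = (\<lambda>p. T p (s p))"

definition tangent_space ::
    "('m, 'e::real_inner, 'f) algebroid \<Rightarrow> 'm \<Rightarrow> (('m \<Rightarrow> real) \<Rightarrow> real) set" where
  "tangent_space A p = {D.
     (\<forall>f\<in>smooth_functions A. \<forall>g\<in>smooth_functions A. D (\<lambda>q. f q + g q) = D f + D g) \<and>
     (\<forall>f\<in>smooth_functions A. \<forall>c. D (\<lambda>q. c * f q) = c * D f) \<and>
     (\<forall>f\<in>smooth_functions A. \<forall>g\<in>smooth_functions A.
        D (\<lambda>q. f q * g q) = f p * D g + D f * g p) \<and>
     (\<forall>f. f \<notin> smooth_functions A \<longrightarrow> D f = 0)}"

text \<open>A vector field along an open set is smooth iff it maps smooth functions to smooth functions.\<close>

definition anchor_map :: "('m, 'e::real_inner, 'f::real_vector) algebroid \<Rightarrow> bool" where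
  "anchor_map A \<longleftrightarrow>
     (\<forall>p. \<forall>v\<in>fibre A p. anchor A p v \<in> tangent_space A p) \<and>
     (\<forall>p. \<forall>v\<in>fibre A p. \<forall>w\<in>fibre A p. \<forall>f. anchor A p (v + w) f = anchor A p v f + anchor A p w f) \<and>
     (\<forall>p. \<forall>v\<in>fibre A p. \<forall>c f. anchor A p (c *\<^sub>R v) f = c * anchor A p v f) \<and>
     (\<forall>(U, r, \<phi>)\<in>trivs A. \<forall>j<r. \<forall>f\<in>smooth_functions A.
        smooth_fun_on (charts A) U (\<lambda>q. anchor A q (frame A \<phi> j q) f))"

definition bundle_map :: "('m, 'e::real_inner, 'f::real_vector) algebroid \<Rightarrow> ('m \<Rightarrow> 'f \<Rightarrow> 'f) \<Rightarrow> bool"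
  where
  "bundle_map A N \<longleftrightarrow>
     (\<forall>p. \<forall>v\<in>fibre A p. N p v \<in> fibre A p) \<and>
     (\<forall>p. \<forall>v\<in>fibre A p. \<forall>w\<in>fibre A p. N p (v + w) = N p v + N p w) \<and>
     (\<forall>p. \<forall>v\<in>fibre A p. \<forall>c. N p (c *\<^sub>R v) = c *\<^sub>R N p v) \<and>
     (\<forall>(U, r, \<phi>)\<in>trivs A. \<forall>i<r. \<forall>j<r.
        smooth_fun_on (charts A) U (\<lambda>q. \<phi> q (N q (frame A \<phi> j q)) i))"

section \<open>Left-symmetric algebroids\<close>

text \<open>The function \<open>a\<^sub>A(x)(f)\<close>.\<close>

definition act :: "('m, 'e, 'f) algebroid \<Rightarrow> ('m \<Rightarrow> 'f) \<Rightarrow> ('m \<Rightarrow> real) \<Rightarrow> 'm \<Rightarrow> real" where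
  "act A x f = (\<lambda>p. anchor A p (x p) f)"

definition bracket ::
    "('m, 'e, 'f::real_vector) algebroid \<Rightarrow> ('m \<Rightarrow> 'f) \<Rightarrow> ('m \<Rightarrow> 'f) \<Rightarrow> ('m \<Rightarrow> 'f)" where
  "bracket A x y = (\<lambda>p. mul A x y p - mul A y x p)"

definition left_symmetric_algebroid ::
    "('m::{t2_space,second_countable_topology}, 'e::real_inner, 'f::real_vector) algebroid \<Rightarrow> bool"
  where
  "left_symmetric_algebroid A \<longleftrightarrow>
     smooth_vector_bundle A \<and> anchor_map A \<and>
     (\<forall>x\<in>sections A. \<forall>y\<in>sections A. mul A x y \<in> sections A) \<and>
     (\<forall>x\<in>sections A. \<forall>y\<in>sections A. \<forall>z\<in>sections A. \<forall>p.
        mul A (\<lambda>q. x q + y q) z p = mul A x z p + mul A y z p \<and>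
        mul A z (\<lambda>q. x q + y q) p = mul A z x p + mul A z y p) \<and>
     (\<forall>x\<in>sections A. \<forall>y\<in>sections A. \<forall>c p.
        mul A (\<lambda>q. c *\<^sub>R x q) y p = c *\<^sub>R mul A x y p \<and>
        mul A x (\<lambda>q. c *\<^sub>R y q) p = c *\<^sub>R mul A x y p) \<and>
     (\<forall>x\<in>sections A. \<forall>y\<in>sections A. \<forall>z\<in>sections A. \<forall>p.
        mul A x (mul A y z) p - mul A (mul A x y) z p =
        mul A y (mul A x z) p - mul A (mul A y x) z p) \<and>
     (\<forall>x\<in>sections A. \<forall>y\<in>sections A. \<forall>f\<in>smooth_functions A. \<forall>p.
        mul A x (\<lambda>q. f q *\<^sub>R y q) p = f p *\<^sub>R mul A x y p + act A x f p *\<^sub>R y p \<and>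
        mul A (\<lambda>q. f q *\<^sub>R x q) y p = f p *\<^sub>R mul A x y p)"

definition nijenhuis_operator ::
    "('m, 'e::real_inner, 'f::real_vector) algebroid \<Rightarrow> ('m \<Rightarrow> 'f \<Rightarrow> 'f) \<Rightarrow> bool" where
  "nijenhuis_operator A N \<longleftrightarrow> bundle_map A N \<and>
     (\<forall>x\<in>sections A. \<forall>y\<in>sections A.
        mul A (app N x) (app N y) =
        app N (\<lambda>p. mul A x (app N y) p + mul A (app N x) y p - app N (mul A x y) p))"

section \<open>Symmetric 2-tensors\<close>

text \<open>A section \<open>H\<close> of \<open>A \<otimes> A\<close> is a smooth family of bilinear forms \<open>H p\<close> on the dual fibres,
  and a section \<open>B\<close> of \<open>A\<^sup>* \<otimes> A\<^sup>*\<close> is a smooth family of bilinear forms \<open>B p\<close> on the fibres. Values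
  outside the (dual) fibres are irrelevant.\<close>

definition Sym2 ::
    "('m, 'e::real_inner, 'f::real_vector) algebroid
       \<Rightarrow> ('m \<Rightarrow> ('f \<Rightarrow> real) \<Rightarrow> ('f \<Rightarrow> real) \<Rightarrow> real) set" where
  "Sym2 A = {H.
     (\<forall>p. \<forall>\<alpha>\<in>dual_fibre A p. \<forall>\<beta>\<in>dual_fibre A p. H p \<alpha> \<beta> = H p \<beta> \<alpha>) \<and>
     (\<forall>p. \<forall>\<alpha>\<in>dual_fibre A p. \<forall>\<beta>\<in>dual_fibre A p. \<forall>\<gamma>\<in>dual_fibre A p.
        H p (\<lambda>v. \<alpha> v + \<beta> v) \<gamma> = H p \<alpha> \<gamma> + H p \<beta> \<gamma>) \<and>
     (\<forall>p. \<forall>\<alpha>\<in>dual_fibre A p. \<forall>\<beta>\<in>dual_fibre A p. \<forall>c. H p (\<lambda>v. c * \<alpha> v) \<beta> = c * H p \<alpha> \<beta>) \<and>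
     (\<forall>(U, r, \<phi>)\<in>trivs A. \<forall>i<r. \<forall>j<r. smooth_fun_on (charts A) U
        (\<lambda>q. H q (\<lambda>v. if v \<in> fibre A q then \<phi> q v i else 0)
                 (\<lambda>v. if v \<in> fibre A q then \<phi> q v j else 0)))}"

definition Sym2_dual ::
    "('m, 'e::real_inner, 'f::real_vector) algebroid \<Rightarrow> ('m \<Rightarrow> 'f \<Rightarrow> 'f \<Rightarrow> real) set" where
  "Sym2_dual A = {B.
     (\<forall>p. \<forall>v\<in>fibre A p. \<forall>w\<in>fibre A p. B p v w = B p w v) \<and>
     (\<forall>p. \<forall>u\<in>fibre A p. \<forall>v\<in>fibre A p. \<forall>w\<in>fibre A p. B p (u + v) w = B p u w + B p v w) \<and>
     (\<forall>p. \<forall>v\<in>fibre A p. \<forall>w\<in>fibre A p. \<forall>c. B p (c *\<^sub>R v) w = c * B p v w) \<and>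
     (\<forall>(U, r, \<phi>)\<in>trivs A. \<forall>i<r. \<forall>j<r. smooth_fun_on (charts A) U
        (\<lambda>q. B q (frame A \<phi> i q) (frame A \<phi> j q)))}"

definition ev :: "('m \<Rightarrow> 'a \<Rightarrow> 'a \<Rightarrow> real) \<Rightarrow> ('m \<Rightarrow> 'a) \<Rightarrow> ('m \<Rightarrow> 'a) \<Rightarrow> 'm \<Rightarrow> real" where
  "ev B x y = (\<lambda>p. B p (x p) (y p))"

text \<open>\<open>sharp A H\<close> is \<open>H\<^sup>\<sharp> : A\<^sup>* \<rightarrow> A\<close>, using the identification of a fibre with its double dual.\<close>

definition sharp ::
    "('m, 'e, 'f::real_vector) algebroid \<Rightarrow> ('m \<Rightarrow> ('f \<Rightarrow> real) \<Rightarrow> ('f \<Rightarrow> real) \<Rightarrow> real)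
       \<Rightarrow> 'm \<Rightarrow> ('f \<Rightarrow> real) \<Rightarrow> 'f" where
  "sharp A H p \<alpha> = (THE v. v \<in> fibre A p \<and> (\<forall>\<beta>\<in>dual_fibre A p. \<beta> v = H p \<alpha> \<beta>))"

definition natmap ::
    "('m, 'e, 'f) algebroid \<Rightarrow> ('m \<Rightarrow> 'f \<Rightarrow> 'f \<Rightarrow> real) \<Rightarrow> 'm \<Rightarrow> 'f \<Rightarrow> ('f \<Rightarrow> real)" where
  "natmap A B p v = (\<lambda>w. if w \<in> fibre A p then B p v w else 0)"

definition nondegenerate ::
    "('m, 'e, 'f::real_vector) algebroid \<Rightarrow> ('m \<Rightarrow> 'f \<Rightarrow> 'f \<Rightarrow> real) \<Rightarrow> bool" where
  "nondegenerate A B \<longleftrightarrow> (\<forall>p. bij_betw (natmap A B p) (fibre A p) (dual_fibre A p))"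

section \<open>Koszul-Vinberg structures and the product on the dual bundle\<close>

definition kv_bracket ::
    "('m, 'e, 'f::real_vector) algebroid \<Rightarrow> ('m \<Rightarrow> ('f \<Rightarrow> real) \<Rightarrow> ('f \<Rightarrow> real) \<Rightarrow> real)
       \<Rightarrow> ('m \<Rightarrow> 'f \<Rightarrow> real) \<Rightarrow> ('m \<Rightarrow> 'f \<Rightarrow> real) \<Rightarrow> ('m \<Rightarrow> 'f \<Rightarrow> real) \<Rightarrow> 'm \<Rightarrow> real" where
  "kv_bracket A H \<alpha>1 \<alpha>2 \<alpha>3 = (let h = app (sharp A H) in (\<lambda>p.
       act A (h \<alpha>1) (pair \<alpha>3 (h \<alpha>2)) p - act A (h \<alpha>2) (pair \<alpha>3 (h \<alpha>1)) p
     + pair \<alpha>1 (mul A (h \<alpha>2) (h \<alpha>3)) p - pair \<alpha>2 (mul A (h \<alpha>1) (h \<alpha>3)) p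
     - pair \<alpha>3 (bracket A (h \<alpha>1) (h \<alpha>2)) p))"

definition koszul_vinberg ::
    "('m, 'e::real_inner, 'f::real_vector) algebroid
       \<Rightarrow> ('m \<Rightarrow> ('f \<Rightarrow> real) \<Rightarrow> ('f \<Rightarrow> real) \<Rightarrow> real) \<Rightarrow> bool" where
  "koszul_vinberg A H \<longleftrightarrow> H \<in> Sym2 A \<and>
     (\<forall>\<alpha>1\<in>dual_sections A. \<forall>\<alpha>2\<in>dual_sections A. \<forall>\<alpha>3\<in>dual_sections A. \<forall>p.
        kv_bracket A H \<alpha>1 \<alpha>2 \<alpha>3 p = 0)"

text \<open>The section of the dual bundle whose pairing with each section \<open>y\<close> is \<open>\<Phi> y\<close>; it exists
  uniquely if \<open>\<Phi>\<close> is linear over the smooth functions and takes smooth values.\<close>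

definition dual_section_of ::
    "('m, 'e::real_inner, 'f::real_vector) algebroid \<Rightarrow> (('m \<Rightarrow> 'f) \<Rightarrow> 'm \<Rightarrow> real)
       \<Rightarrow> 'm \<Rightarrow> 'f \<Rightarrow> real" where
  "dual_section_of A \<Phi> =
     (THE \<theta>. \<theta> \<in> dual_sections A \<and> (\<forall>y\<in>sections A. \<forall>p. pair \<theta> y p = \<Phi> y p))"

definition lie_derivative ::
    "('m, 'e::real_inner, 'f::real_vector) algebroid \<Rightarrow> ('m \<Rightarrow> 'f) \<Rightarrow> ('m \<Rightarrow> 'f \<Rightarrow> real)
       \<Rightarrow> 'm \<Rightarrow> 'f \<Rightarrow> real" where
  "lie_derivative A x \<alpha> =
     dual_section_of A (\<lambda>y p. act A x (pair \<alpha> y) p - pair \<alpha> (bracket A x y) p)"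

definition dual_right_mult ::
    "('m, 'e::real_inner, 'f::real_vector) algebroid \<Rightarrow> ('m \<Rightarrow> 'f) \<Rightarrow> ('m \<Rightarrow> 'f \<Rightarrow> real)
       \<Rightarrow> 'm \<Rightarrow> 'f \<Rightarrow> real" where
  "dual_right_mult A x \<alpha> = dual_section_of A (\<lambda>y p. - pair \<alpha> (mul A y x) p)"

definition differential ::
    "('m, 'e::real_inner, 'f::real_vector) algebroid \<Rightarrow> ('m \<Rightarrow> real) \<Rightarrow> 'm \<Rightarrow> 'f \<Rightarrow> real" where
  "differential A f = dual_section_of A (\<lambda>x. act A x f)"

definition dual_mul ::
    "('m, 'e::real_inner, 'f::real_vector) algebroid
       \<Rightarrow> ('m \<Rightarrow> ('f \<Rightarrow> real) \<Rightarrow> ('f \<Rightarrow> real) \<Rightarrow> real)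
       \<Rightarrow> ('m \<Rightarrow> 'f \<Rightarrow> real) \<Rightarrow> ('m \<Rightarrow> 'f \<Rightarrow> real) \<Rightarrow> 'm \<Rightarrow> 'f \<Rightarrow> real" where
  "dual_mul A H \<alpha> \<beta> = (\<lambda>p v.
       lie_derivative A (app (sharp A H) \<alpha>) \<beta> p v
     - dual_right_mult A (app (sharp A H) \<beta>) \<alpha> p v
     - differential A (ev H \<alpha> \<beta>) p v)"

section \<open>Complementary tensors and pseudo-Hessian-Nijenhuis structures\<close>

definition dual_kv_bracket ::
    "('m, 'e::real_inner, 'f::real_vector) algebroid
       \<Rightarrow> ('m \<Rightarrow> ('f \<Rightarrow> real) \<Rightarrow> ('f \<Rightarrow> real) \<Rightarrow> real) \<Rightarrow> ('m \<Rightarrow> 'f \<Rightarrow> 'f \<Rightarrow> real)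
       \<Rightarrow> ('m \<Rightarrow> 'f) \<Rightarrow> ('m \<Rightarrow> 'f) \<Rightarrow> ('m \<Rightarrow> 'f) \<Rightarrow> 'm \<Rightarrow> real" where
  "dual_kv_bracket A H B x1 x2 x3 =
     (let h = app (sharp A H); b = app (natmap A B) in (\<lambda>p.
       act A (h (b x1)) (pair (b x2) x3) p - act A (h (b x2)) (pair (b x1) x3) p
     + pair (dual_mul A H (b x2) (b x3)) x1 p - pair (dual_mul A H (b x1) (b x3)) x2 p
     - pair (\<lambda>q v. dual_mul A H (b x1) (b x2) q v - dual_mul A H (b x2) (b x1) q v) x3 p))"

definition complementary ::
    "('m, 'e::real_inner, 'f::real_vector) algebroid
       \<Rightarrow> ('m \<Rightarrow> ('f \<Rightarrow> real) \<Rightarrow> ('f \<Rightarrow> real) \<Rightarrow> real) \<Rightarrow> ('m \<Rightarrow> 'f \<Rightarrow> 'f \<Rightarrow> real) \<Rightarrow> bool" where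
  "complementary A H B \<longleftrightarrow> B \<in> Sym2_dual A \<and>
     (\<forall>x1\<in>sections A. \<forall>x2\<in>sections A. \<forall>x3\<in>sections A. \<forall>p. dual_kv_bracket A H B x1 x2 x3 p = 0)"

definition coboundary ::
    "('m, 'e, 'f::real_vector) algebroid \<Rightarrow> ('m \<Rightarrow> 'f \<Rightarrow> 'f \<Rightarrow> real)
       \<Rightarrow> ('m \<Rightarrow> 'f) \<Rightarrow> ('m \<Rightarrow> 'f) \<Rightarrow> ('m \<Rightarrow> 'f) \<Rightarrow> 'm \<Rightarrow> real" where
  "coboundary A B x y z = (\<lambda>p.
       act A x (ev B y z) p - act A y (ev B x z) p
     - ev B y (mul A x z) p + ev B x (mul A y z) p - ev B (bracket A x y) z p)"

definition two_cocycle ::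
    "('m, 'e::real_inner, 'f::real_vector) algebroid \<Rightarrow> ('m \<Rightarrow> 'f \<Rightarrow> 'f \<Rightarrow> real) \<Rightarrow> bool" where
  "two_cocycle A B \<longleftrightarrow> B \<in> Sym2_dual A \<and>
     (\<forall>x\<in>sections A. \<forall>y\<in>sections A. \<forall>z\<in>sections A. \<forall>p. coboundary A B x y z p = 0)"

abbreviation (input) "pseudo_hessian \<equiv> two_cocycle"

definition pseudo_hessian_nijenhuis ::
    "('m, 'e::real_inner, 'f::real_vector) algebroid \<Rightarrow> ('m \<Rightarrow> 'f \<Rightarrow> 'f \<Rightarrow> real)
       \<Rightarrow> ('m \<Rightarrow> 'f \<Rightarrow> 'f) \<Rightarrow> bool" where
  "pseudo_hessian_nijenhuis A B N \<longleftrightarrow>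
     pseudo_hessian A B \<and> nijenhuis_operator A N \<and>
     (\<forall>x\<in>sections A. \<forall>y\<in>sections A. \<forall>p. ev B (app N x) y p = ev B x (app N y) p) \<and>
     (\<forall>x\<in>sections A. \<forall>y\<in>sections A. \<forall>z\<in>sections A. \<forall>p.
        coboundary A (\<lambda>q v w. B q (N q v) w) x y z p = 0)"

end

theory Submission
  imports Defs "Jordan_Normal_Form.Determinant"
begin

text \<open>Write \<open>b = B\<^sup>\<natural>\<close>, \<open>h = H\<^sup>\<sharp>\<close> and \<open>N = h \<circ> b\<close>, which is self-adjoint for \<open>B\<close>,
  and let \<open>B\<^sub>N(x, y) = B(N x, y)\<close>.
  For a 2-cocycle \<open>B\<close> two identities on sections hold.
  First, the bracket of \<open>B\<close> on the dual algebroid is the coboundary of \<open>B\<^sub>N\<close>. Second,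
  the bracket of \<open>H\<close> on \<open>b x, b y, b z\<close> plus the coboundary of \<open>B\<^sub>N\<close> on \<open>x, N y, z\<close> is
  \<open>B(y, N(x \<cdot> N z + N x \<cdot> z - N(x \<cdot> z)) - N x \<cdot> N z)\<close>, the Nijenhuis torsion paired with \<open>y\<close>.
  So complementarity means that \<open>B\<^sub>N\<close> is closed, and then, \<open>B\<close> being nondegenerate, the
  Koszul-Vinberg condition on \<open>H\<close> means that \<open>N\<close> is a Nijenhuis operator.

  The analytic input is that a bump function makes local frames global, so that an operator on
  sections which is linear over the smooth functions is given by a section of the dual bundle,
  and that \<open>b\<^sup>-\<^sup>1\<close> is smooth by Cramer's rule.\<close>

section \<open>Iterated differentiability\<close>

text \<open>The product on the dual bundle is a definite description over sections, so nothing can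
  be computed with it until its three constituents are known to be tensorial and tensorial operators
  are known to be represented. This is what calls for bump functions, and for a class of smooth
  functions closed under products, reciprocals and composition with the flat function. A bump
  function is only required to be nonzero at one point: where a plateau of height 1 would be
  customary, its value is divided out instead.

  Both identities are sums of cocycle conditions for \<open>B\<close> with \<open>N\<close> inserted
  into two or three different argument patterns; the Leibniz terms cancel because \<open>N\<close>
  is self-adjoint. That self-adjointness is the symmetry of \<open>H\<close> in another form. Hence
  both directions of the theorem fit one setting, a symmetric \<open>H\<close> and a bundle map
  \<open>N\<close> linked by \<open>h \<circ> b = N\<close>, and become the two halves of one
  equivalence; they differ only in which of \<open>H\<close> and \<open>N\<close> is constructed.
  Conditions on sections and conditions on fibres are exchanged by extending a vector to a global
  section.\<close>

lemma times_differentiable_on_SucD: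
  "times_differentiable_on (Suc k) S f \<Longrightarrow> times_differentiable_on k S f"
proof (induction k arbitrary: f)
  case 0
  then show ?case
    by (simp add: continuous_at_imp_continuous_on differentiable_imp_continuous_within)
next
  case (Suc k)
  note * = Suc.prems[unfolded times_differentiable_on.simps(2)[of "Suc k"]]
  show ?case
    unfolding times_differentiable_on.simps(2)[of k]
    by (intro conjI allI conjunct1[OF *] Suc.IH spec[OF conjunct2[OF *]])
qed

lemma times_differentiable_on_SucE:
  assumes "times_differentiable_on (Suc k) S f" "x \<in> S"
  shows "(f has_derivative frechet_derivative f (at x)) (at x)"
  using assms frechet_derivative_works by auto

text \<open>\<open>frechet_derivative\<close> is a choice from the set of derivatives, so equality
  of these sets also covers points where there is no derivative.\<close>

lemma frechet_derivative_cong: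
  assumes "open S" "x \<in> S" "\<And>y. y \<in> S \<Longrightarrow> f y = g y"
  shows "frechet_derivative f (at x) = frechet_derivative g (at x)"
proof -
  have "(f has_derivative D) (at x) \<longleftrightarrow> (g has_derivative D) (at x)" for D
    by (rule iffI; erule has_derivative_transform_within_open[OF _ assms(1,2)]) (simp_all add: assms(3))
  then show ?thesis
    unfolding frechet_derivative_def by simp
qed

lemma times_differentiable_on_cong:
  assumes "open S" "\<And>x. x \<in> S \<Longrightarrow> f x = g x" "times_differentiable_on k S f"
  shows "times_differentiable_on k S g"
  using assms(2,3)
proof (induction k arbitrary: f g)
  case 0
  then show ?case by (simp cong: continuous_on_cong)
next
  case (Suc k)
  have "g differentiable (at x)" if "x \<in> S" for x
    using has_derivative_transform_within_open[OF times_differentiable_on_SucE[OF Suc.prems(2) that]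
        assms(1) that, of g] Suc.prems(1) unfolding differentiable_def by blast
  moreover have "times_differentiable_on k S (\<lambda>x. frechet_derivative g (at x) v)" for v
  proof (rule Suc.IH)
    show "frechet_derivative f (at x) v = frechet_derivative g (at x) v" if "x \<in> S" for x
      using frechet_derivative_cong[OF assms(1) that, of f g] Suc.prems(1) by simp
  qed (use Suc.prems(2) in auto)
  ultimately show ?case by simp
qed

lemma times_differentiable_on_subset:
  "times_differentiable_on k S f \<Longrightarrow> T \<subseteq> S \<Longrightarrow> times_differentiable_on k T f"
  by (induction k arbitrary: f) (auto elim: continuous_on_subset)

lemma times_differentiable_on_UN:
  assumes "\<And>i. i \<in> I \<Longrightarrow> open (S i)" "\<And>i. i \<in> I \<Longrightarrow> times_differentiable_on k (S i) f"
  shows "times_differentiable_on k (\<Union>i\<in>I. S i) f"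
  using assms(2)
proof (induction k arbitrary: f)
  case 0
  then show ?case using continuous_on_open_UN[of I S f] assms(1) by simp
next
  case (Suc k)
  then show ?case by simp
qed

lemma times_differentiable_on_const:
  "times_differentiable_on k S (\<lambda>x. c)"
  by (induction k arbitrary: c) auto

text \<open>Lets a closure rule supply its own derivative \<open>D\<close>. Since \<open>D x\<close>
  agrees with \<open>frechet_derivative\<close> on \<open>S\<close> only, openness is needed to
  replace one by the other.\<close>

lemma times_differentiable_on_SucI:
  assumes "open S" "\<And>x. x \<in> S \<Longrightarrow> (f has_derivative D x) (at x)"
    "\<And>v. times_differentiable_on k S (\<lambda>x. D x v)"
  shows "times_differentiable_on (Suc k) S f"
proof -
  have "frechet_derivative f (at x) = D x" if "x \<in> S" for x
    using frechet_derivative_at[OF assms(2)[OF that]] by simp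
  then have "times_differentiable_on k S (\<lambda>x. frechet_derivative f (at x) v)" for v
    using times_differentiable_on_cong[OF assms(1) _ assms(3)[of v]] by simp
  then show ?thesis
    using assms(2) by (auto simp: differentiable_def)
qed

lemma times_differentiable_on_add:
  assumes "open S" "times_differentiable_on k S f" "times_differentiable_on k S g"
  shows "times_differentiable_on k S (\<lambda>x. f x + g x)"
  using assms(2,3)
proof (induction k arbitrary: f g)
  case 0
  then show ?case by (auto intro: continuous_intros)
next
  case (Suc k)
  show ?case
    by (rule times_differentiable_on_SucI[OF assms(1) has_derivative_add
          [OF times_differentiable_on_SucE[OF Suc.prems(1)] times_differentiable_on_SucE[OF Suc.prems(2)]]])
      (use Suc in auto)
qed

text \<open>One product rule for both real multiplication and the inner product.\<close>

lemma times_differentiable_on_bilinear: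
  assumes "bounded_bilinear b" "open S" "times_differentiable_on k S f" "times_differentiable_on k S g"
  shows "times_differentiable_on k S (\<lambda>x. b (f x) (g x))"
  using assms(3,4)
proof (induction k arbitrary: f g)
  case 0
  then show ?case using bounded_bilinear.continuous_on[OF assms(1)] by auto
next
  case (Suc k)
  note f = Suc.prems(1) and g = Suc.prems(2)
  show ?case
  proof (rule times_differentiable_on_SucI[OF assms(2)])
    show "((\<lambda>x. b (f x) (g x)) has_derivative
        (\<lambda>v. b (f x) (frechet_derivative g (at x) v) + b (frechet_derivative f (at x) v) (g x))) (at x)"
      if "x \<in> S" for x
      by (rule bounded_bilinear.FDERIV[OF assms(1)])
        (rule times_differentiable_on_SucE[OF f that] times_differentiable_on_SucE[OF g that])+
    show "times_differentiable_on k S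
       (\<lambda>x. b (f x) (frechet_derivative g (at x) v) + b (frechet_derivative f (at x) v) (g x))" for v
      \<comment> \<open>Each term of the product rule keeps one factor undifferentiated, so order
        \<open>k\<close> of \<open>f\<close> and \<open>g\<close> themselves is needed too.\<close>
      using f g times_differentiable_on_SucD[OF f] times_differentiable_on_SucD[OF g]
      by (intro times_differentiable_on_add assms Suc.IH) auto
  qed
qed

text \<open>The derivative of \<open>F\<close> at a real number is multiplication by its value at 1,
  so the chain rule gives a product, which the bilinear rule covers; the induction runs over
  \<open>F\<close>, with \<open>f\<close> fixed.\<close>

lemma times_differentiable_on_compose_real:
  fixes f :: "'a::real_normed_vector \<Rightarrow> real" and F :: "real \<Rightarrow> real"
  assumes "open S" "f ` S \<subseteq> T" "times_differentiable_on k T F" "times_differentiable_on k S f"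
  shows "times_differentiable_on k S (\<lambda>x. F (f x))"
  using assms(3,4)
proof (induction k arbitrary: F)
  case 0
  then show ?case
    using continuous_on_compose2[OF _ _ assms(2)] by simp
next
  case (Suc k)
  note F = Suc.prems(1) and f = Suc.prems(2)
  have fT: "f x \<in> T" if "x \<in> S" for x using assms(2) that by auto
  show ?case
  proof (rule times_differentiable_on_SucI[OF assms(1)])
    show "((\<lambda>x. F (f x)) has_derivative
        (\<lambda>v. frechet_derivative f (at x) v * frechet_derivative F (at (f x)) 1)) (at x)"
      if "x \<in> S" for x
    proof -
      have D: "(F has_derivative frechet_derivative F (at (f x))) (at (f x))"
        using times_differentiable_on_SucE[OF F fT[OF that]] .
      have "frechet_derivative F (at (f x)) t = t * frechet_derivative F (at (f x)) 1" for t
        using linear_cmul[OF has_derivative_linear[OF D], of t 1] by simp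
      then have "(\<lambda>v. frechet_derivative F (at (f x)) (frechet_derivative f (at x) v)) =
          (\<lambda>v. frechet_derivative f (at x) v * frechet_derivative F (at (f x)) 1)"
        by blast
      then show ?thesis
        using has_derivative_compose[OF times_differentiable_on_SucE[OF f that] D] by simp
    qed
    show "times_differentiable_on k S
        (\<lambda>x. frechet_derivative f (at x) v * frechet_derivative F (at (f x)) 1)" for v
    proof (rule times_differentiable_on_bilinear[OF bounded_bilinear_mult assms(1)])
      show "times_differentiable_on k S (\<lambda>x. frechet_derivative F (at (f x)) 1)"
        using Suc.IH[of "\<lambda>y. frechet_derivative F (at y) 1"] F times_differentiable_on_SucD[OF f]
        by simp
    qed (use f in simp)
  qed
qed

section \<open>Smooth maps on open sets\<close>

lemma smooth_on_cong:
  "open S \<Longrightarrow> (\<And>x. x \<in> S \<Longrightarrow> f x = g x) \<Longrightarrow> smooth_on S f \<Longrightarrow> smooth_on S g"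
  by (simp add: smooth_on_def times_differentiable_on_cong[of S f g])

lemma smooth_on_subset: "smooth_on S f \<Longrightarrow> T \<subseteq> S \<Longrightarrow> smooth_on T f"
  using times_differentiable_on_subset[of _ S f T] by (simp add: smooth_on_def)

lemma smooth_on_UN:
  "(\<And>i. i \<in> I \<Longrightarrow> open (S i)) \<Longrightarrow> (\<And>i. i \<in> I \<Longrightarrow> smooth_on (S i) f) \<Longrightarrow> smooth_on (\<Union>i\<in>I. S i) f"
  by (simp add: smooth_on_def times_differentiable_on_UN)

lemma smooth_on_const: "smooth_on S (\<lambda>x. c)"
  by (simp add: smooth_on_def times_differentiable_on_const)

lemma smooth_on_add:
  "open S \<Longrightarrow> smooth_on S f \<Longrightarrow> smooth_on S g \<Longrightarrow> smooth_on S (\<lambda>x. f x + g x)"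
  by (simp add: smooth_on_def times_differentiable_on_add)

lemma smooth_on_bilinear:
  "bounded_bilinear b \<Longrightarrow> open S \<Longrightarrow> smooth_on S f \<Longrightarrow> smooth_on S g \<Longrightarrow> smooth_on S (\<lambda>x. b (f x) (g x))"
  by (simp add: smooth_on_def times_differentiable_on_bilinear)

lemmas smooth_on_mult = smooth_on_bilinear[OF bounded_bilinear_mult]

lemma smooth_on_compose_real:
  fixes f :: "'a::real_normed_vector \<Rightarrow> real" and F :: "real \<Rightarrow> real"
  shows "open S \<Longrightarrow> f ` S \<subseteq> T \<Longrightarrow> smooth_on T F \<Longrightarrow> smooth_on S f \<Longrightarrow> smooth_on S (\<lambda>x. F (f x))"
  by (simp add: smooth_on_def times_differentiable_on_compose_real)

text \<open>The derivative is again a polynomial in the reciprocal, which closes the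
  induction.\<close>

lemma times_differentiable_on_inverse_real:
  "times_differentiable_on k (- {0}) (inverse :: real \<Rightarrow> real)"
proof (induction k)
  case 0
  then show ?case by (auto intro: continuous_intros)
next
  case (Suc k)
  have "times_differentiable_on k (- {0}) (\<lambda>x. - v * (inverse x * inverse x))" for v :: real
    by (intro times_differentiable_on_bilinear[OF bounded_bilinear_mult] Suc
        times_differentiable_on_const) auto
  then show ?case
    by (intro times_differentiable_on_SucI[where D = "\<lambda>x v. - v * (inverse x * inverse x)"])
      (auto intro!: derivative_eq_intros)
qed

lemma smooth_on_inverse:
  fixes f :: "'a::real_normed_vector \<Rightarrow> real"
  assumes "open S" "smooth_on S f" "\<And>x. x \<in> S \<Longrightarrow> f x \<noteq> 0"
  shows "smooth_on S (\<lambda>x. inverse (f x))"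
  by (rule smooth_on_compose_real[of _ _ "- {0}"])
    (use assms times_differentiable_on_inverse_real in \<open>auto simp: smooth_on_def\<close>)

text \<open>The family is closed under differentiation, so that all the derivatives of
  \<open>exp (- 1 / t)\<close> at the origin are handled at once.\<close>

definition flat :: "nat \<Rightarrow> real \<Rightarrow> real" where
  "flat n t = (if t > 0 then inverse t ^ n * exp (- inverse t) else 0)"

text \<open>With \<open>s = 1 / t\<close> the limit from the right is the decay of
  \<open>s ^ n / exp s\<close> at infinity; from the left the function is 0.\<close>

lemma flat_tendsto_0: "((\<lambda>t. flat n t) \<longlongrightarrow> 0) (at 0)"
proof -
  have "((\<lambda>s::real. s ^ n / exp s) \<longlongrightarrow> 0) at_top"
    by (rule tendsto_power_div_exp_0)
  then have "((\<lambda>t::real. inverse t ^ n / exp (inverse t)) \<longlongrightarrow> 0) (at_right 0)"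
    by (rule filterlim_compose[OF _ filterlim_inverse_at_top_right])
  then have "(flat n \<longlongrightarrow> 0) (at_right 0)"
    by (rule Lim_transform_eventually)
      (auto simp: flat_def eventually_at_filter exp_minus field_simps)
  moreover have "(flat n \<longlongrightarrow> 0) (at_left 0)"
    by (rule Lim_transform_eventually[OF tendsto_const])
      (auto simp: flat_def eventually_at_filter)
  ultimately show ?thesis
    by (rule filterlim_split_at[rotated])
qed

lemma has_real_derivative_flat:
  "(flat n has_real_derivative flat (n + 2) t - of_nat n * flat (n + 1) t) (at t)"
proof -
  consider "t > 0" | "t < 0" | "t = 0" by linarith
  then show ?thesis
  proof cases
    case 1
    have "((\<lambda>t. inverse t ^ n * exp (- inverse t)) has_real_derivative
        flat (n + 2) t - of_nat n * flat (n + 1) t) (at t)"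
    \<comment> \<open>The power rule lowers the exponent by one, hence the separate case 0.\<close>
    proof (cases n)
      case 0
      show ?thesis
        using 1 unfolding 0 by (auto intro!: derivative_eq_intros simp: flat_def power2_eq_square)
    next
      case (Suc m)
      show ?thesis
        using 1 unfolding Suc
        by (auto intro!: derivative_eq_intros simp: flat_def simp flip: power_inverse)
          (cases m; simp add: algebra_simps)
    qed
    then show ?thesis
      by (rule has_field_derivative_transform_within_open[of _ _ _ "{0<..}"]) (auto simp: flat_def 1)
  next
    case 2
    then show ?thesis
      using has_field_derivative_transform_within_open[of "\<lambda>t. 0" 0 t "{..<0}" "flat n"]
      by (auto simp: flat_def)
  next
    case 3
    \<comment> \<open>The difference quotient of \<open>flat n\<close> at the origin is
      \<open>flat (Suc n)\<close>, which tends to 0; the claimed derivative is 0 there as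
      well.\<close>
    have "((\<lambda>t. flat n t / t) \<longlongrightarrow> 0) (at 0)"
      by (rule Lim_transform_eventually[OF flat_tendsto_0[of "Suc n"]])
        (auto simp: flat_def field_simps eventually_at_filter)
    then show ?thesis
      using 3 by (simp add: has_field_derivative_iff flat_def)
  qed
qed

lemma times_differentiable_on_flat: "times_differentiable_on k UNIV (flat n)"
proof (induction k arbitrary: n)
  case 0
  then show ?case
    using DERIV_isCont[OF has_real_derivative_flat] by (simp add: continuous_on_eq_continuous_at)
next
  case (Suc k)
  let ?D = "\<lambda>t. flat (n + 2) t + - of_nat n * flat (n + 1) t"
  have "times_differentiable_on k UNIV (\<lambda>t. ?D t * v)" for v
    by (intro times_differentiable_on_bilinear[OF bounded_bilinear_mult]
        times_differentiable_on_const times_differentiable_on_add Suc) auto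
  then show ?case
    using has_real_derivative_flat[of n]
    by (intro times_differentiable_on_SucI[where D = "\<lambda>t v. ?D t * v"])
      (auto simp: has_field_derivative_def mult_commute_abs)
qed

lemma smooth_on_flat: "smooth_on UNIV (flat n)"
  by (simp add: smooth_on_def times_differentiable_on_flat)

section \<open>Compact neighbourhoods in finite dimension\<close>

text \<open>Without the class \<open>euclidean_space\<close>, balls are compared with cubes in an orthogonal basis,
  which are iterated sums of segments and hence compact.\<close>

lemma compact_linear_combinations:
  fixes S :: "'a::real_normed_vector set"
  assumes "finite S"
  shows "compact {\<Sum>b\<in>S. c b *\<^sub>R b | c. \<forall>b\<in>S. \<bar>c b\<bar> \<le> r b}" (is "compact (?K S)")
  using assms
proof induction
  case empty
  then show ?case by simp
next
  case (insert b S)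
  have "?K (insert b S) = {u + v | u v. u \<in> (\<lambda>t. t *\<^sub>R b) ` {- r b .. r b} \<and> v \<in> ?K S}"
    (is "_ = ?R")
  proof (intro Set.set_eqI iffI)
    fix w assume "w \<in> ?K (insert b S)"
    then obtain c where "w = (\<Sum>b\<in>insert b S. c b *\<^sub>R b)" "\<forall>b\<in>insert b S. \<bar>c b\<bar> \<le> r b"
      by blast
    then show "w \<in> ?R"
      using insert.hyps
      by (intro CollectI exI[of _ "c b *\<^sub>R b"] exI[of _ "\<Sum>b\<in>S. c b *\<^sub>R b"]) (auto simp: abs_le_iff)
  next
    fix w assume "w \<in> ?R"
    then obtain t c where t: "t \<in> {- r b .. r b}" "w = t *\<^sub>R b + (\<Sum>b\<in>S. c b *\<^sub>R b)"
      "\<forall>b\<in>S. \<bar>c b\<bar> \<le> r b" by blast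
    have "(\<Sum>a\<in>S. (c(b := t)) a *\<^sub>R a) = (\<Sum>b\<in>S. c b *\<^sub>R b)"
      using insert.hyps(2) by (intro sum.cong) auto
    then show "w \<in> ?K (insert b S)"
      using t insert.hyps by (intro CollectI exI[of _ "c(b := t)"]) auto
  qed
  moreover have "compact ((\<lambda>t. t *\<^sub>R b) ` {- r b .. r b})"
    by (intro compact_continuous_image compact_Icc) (auto intro!: continuous_intros)
  ultimately show ?case
    using compact_sums[OF _ insert.IH] by simp
qed

lemma orthogonal_expansion:
  fixes w :: "'e::real_inner"
  assumes "finite S" "pairwise real_inner_class.orthogonal S" "w \<in> span S"
  shows "w = (\<Sum>b\<in>S. (inner w b / inner b b) *\<^sub>R b)"
proof -
  obtain v where v: "w = (\<Sum>b\<in>S. v b *\<^sub>R b)"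
    using assms(1,3) by (auto simp: span_finite)
  have "inner w b = v b * inner b b" if "b \<in> S" for b
  proof -
    have "inner w b = (\<Sum>a\<in>S. if a = b then v b * inner b b else 0)"
      unfolding v inner_sum_left using assms(2) that
      by (intro sum.cong) (auto simp: pairwise_def real_inner_class.orthogonal_def)
    then show ?thesis using that assms(1) by simp
  qed
  \<comment> \<open>\<open>S\<close> may contain the zero vector; its term vanishes whatever the
    coefficient.\<close>
  then have "v b *\<^sub>R b = (inner w b / inner b b) *\<^sub>R b" if "b \<in> S" for b
    using that by (cases "b = 0") auto
  then show ?thesis by (subst v) (rule sum.cong[OF refl])
qed

lemma ball_subset_compact_subset_ball:
  fixes x :: "'e::real_inner"
  assumes "finite S" "span S = (UNIV :: 'e set)" "e > 0"
  obtains d K where "d > 0" "compact K" "ball x d \<subseteq> K" "K \<subseteq> ball x e"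
proof -
  obtain C where C: "finite C" "span C = (UNIV :: 'e set)" "pairwise real_inner_class.orthogonal C"
    using basis_orthogonal[OF assms(1)] assms(2) by auto
  \<comment> \<open>A point of the cube is a sum of \<open>card C\<close> vectors of norm at most
    \<open>d\<close>. The added 1 makes the final inequality strict and covers the empty basis of a
    space of dimension 0.\<close>
  define d where "d = e / (card C + 1)"
  have d: "d > 0" "card C * d < e"
    using assms(3) by (auto simp: d_def field_simps)
  \<comment> \<open>\<open>d / norm b\<close> is the bound that Cauchy-Schwarz gives for the
    coefficient \<open>inner w b / inner b b\<close> of a vector \<open>w\<close> of norm at most
    \<open>d\<close>; for \<open>b = 0\<close> both quotients are 0 by convention.\<close>
  define K where "K = {\<Sum>b\<in>C. c b *\<^sub>R b | c. \<forall>b\<in>C. \<bar>c b\<bar> \<le> d / norm b}"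
  show thesis
  proof
    show "d > 0" by (fact d)
    show "compact ((+) x ` K)"
      unfolding K_def by (intro compact_translation compact_linear_combinations C)
    show "ball x d \<subseteq> (+) x ` K"
    proof
      fix y assume y: "y \<in> ball x d"
      let ?w = "y - x"
      have "\<bar>inner ?w b / inner b b\<bar> \<le> d / norm b" for b
      proof (cases "b = 0")
        case False
        have "\<bar>inner ?w b\<bar> \<le> d * norm b"
          using Cauchy_Schwarz_ineq2[of ?w b] y
            mult_right_mono[of "norm ?w" d "norm b"] by (simp add: dist_norm norm_minus_commute)
        then show ?thesis
          using False by (simp add: field_simps dot_square_norm power2_eq_square)
      qed simp
      moreover have "?w = (\<Sum>b\<in>C. (inner ?w b / inner b b) *\<^sub>R b)"
        using orthogonal_expansion[OF C(1,3)] C(2) by simp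
      ultimately have "?w \<in> K"
        unfolding K_def by (intro CollectI exI[of _ "\<lambda>b. inner ?w b / inner b b"]) simp
      then show "y \<in> (+) x ` K" by (intro image_eqI[of _ _ ?w]) auto
    qed
    show "(+) x ` K \<subseteq> ball x e"
    proof (clarsimp simp: K_def dist_norm)
      fix c assume c: "\<forall>b\<in>C. \<bar>c b\<bar> \<le> d / norm b"
      have "norm (c b *\<^sub>R b) \<le> d" if "b \<in> C" for b
        using bspec[OF c that] d(1) by (cases "b = 0") (auto simp: field_simps)
      then have "norm (\<Sum>b\<in>C. c b *\<^sub>R b) \<le> (\<Sum>b\<in>C. d)"
        by (intro sum_norm_le) simp
      then show "norm (\<Sum>b\<in>C. c b *\<^sub>R b) < e" using d(2) by simp
    qed
  qed
qed

section \<open>Smooth functions on a manifold\<close>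

locale smooth_manifold =
  fixes C :: "('m::{t2_space,second_countable_topology} set \<times> ('m \<Rightarrow> 'e::real_inner)) set"
  assumes atlas: "smooth_atlas C"
begin

lemma chart:
  assumes "(U, \<psi>) \<in> C"
  shows "open U" "open (\<psi> ` U)" "homeomorphism U (\<psi> ` U) \<psi> (inv_into U \<psi>)"
  using atlas assms by (auto simp: smooth_atlas_def)

lemma chart_inv [simp]: "(U, \<psi>) \<in> C \<Longrightarrow> q \<in> U \<Longrightarrow> inv_into U \<psi> (\<psi> q) = q"
  by (rule homeomorphism_apply1[OF chart(3)])

lemma chart_at: obtains U \<psi> where "(U, \<psi>) \<in> C" "p \<in> U"
  using atlas unfolding smooth_atlas_def by blast

lemma chart_transition:
  "(U, \<psi>) \<in> C \<Longrightarrow> (U', \<psi>') \<in> C \<Longrightarrow> smooth_on (\<psi> ` (U \<inter> U')) (\<psi>' \<circ> inv_into U \<psi>)"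
  using atlas unfolding smooth_atlas_def by fast

lemma open_chart_image:
  assumes "(U, \<psi>) \<in> C" "open W"
  shows "open (\<psi> ` (U \<inter> W))"
proof -
  have "openin (top_of_set (\<psi> ` U)) (\<psi> ` (U \<inter> W))"
    using homeomorphism_imp_open_map[OF chart(3)[OF assms(1)], of "U \<inter> W"] assms(2)
    by (simp add: openin_open_Int)
  then show ?thesis
    using chart(2)[OF assms(1)] by (simp add: openin_open_eq)
qed

lemma smooth_fun_onD:
  "smooth_fun_on C W f \<Longrightarrow> (U, \<psi>) \<in> C \<Longrightarrow> smooth_on (\<psi> ` (U \<inter> W)) (\<lambda>y. f (inv_into U \<psi> y))"
  unfolding smooth_fun_on_def comp_def by (drule (1) bspec) simp

lemma smooth_fun_onI:
  assumes "\<And>U \<psi>. (U, \<psi>) \<in> C \<Longrightarrow> open (\<psi> ` (U \<inter> W)) \<Longrightarrow>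
      smooth_on (\<psi> ` (U \<inter> W)) (\<lambda>y. f (inv_into U \<psi> y))"
    "open W"
  shows "smooth_fun_on C W f"
  unfolding smooth_fun_on_def comp_def
  by clarify (rule assms(1)[OF _ open_chart_image[OF _ assms(2)]])

lemma smooth_fun_on_cong:
  assumes "open W" "smooth_fun_on C W f" "\<And>q. q \<in> W \<Longrightarrow> f q = g q"
  shows "smooth_fun_on C W g"
proof (rule smooth_fun_onI[OF _ assms(1)])
  fix U \<psi> assume U: "(U, \<psi>) \<in> C" and o: "open (\<psi> ` (U \<inter> W))"
  show "smooth_on (\<psi> ` (U \<inter> W)) (\<lambda>y. g (inv_into U \<psi> y))"
    by (rule smooth_on_cong[OF o _ smooth_fun_onD[OF assms(2) U]]) (use U assms(3) in auto)
qed

lemma smooth_fun_on_subset: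
  "smooth_fun_on C W f \<Longrightarrow> V \<subseteq> W \<Longrightarrow> smooth_fun_on C V f"
  unfolding smooth_fun_on_def by clarify (drule (1) bspec, auto elim!: smooth_on_subset)

lemma smooth_fun_on_UN:
  assumes "\<And>i. i \<in> I \<Longrightarrow> open (V i)" "\<And>i. i \<in> I \<Longrightarrow> smooth_fun_on C (V i) f"
  shows "smooth_fun_on C (\<Union>i\<in>I. V i) f"
proof (rule smooth_fun_onI)
  fix U \<psi> assume U: "(U, \<psi>) \<in> C"
  have "smooth_on (\<Union>i\<in>I. \<psi> ` (U \<inter> V i)) (\<lambda>y. f (inv_into U \<psi> y))"
  proof (rule smooth_on_UN)
    fix i assume i: "i \<in> I"
    show "open (\<psi> ` (U \<inter> V i))" by (rule open_chart_image[OF U assms(1)[OF i]])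
    show "smooth_on (\<psi> ` (U \<inter> V i)) (\<lambda>y. f (inv_into U \<psi> y))"
      by (rule smooth_fun_onD[OF assms(2)[OF i] U])
  qed
  moreover have "(\<Union>i\<in>I. \<psi> ` (U \<inter> V i)) = \<psi> ` (U \<inter> (\<Union>i\<in>I. V i))" by blast
  ultimately show "smooth_on (\<psi> ` (U \<inter> (\<Union>i\<in>I. V i))) (\<lambda>y. f (inv_into U \<psi> y))"
    by simp
qed (use assms in auto)

lemma smooth_fun_on_locally:
  assumes "\<And>p. p \<in> W \<Longrightarrow> \<exists>V. open V \<and> p \<in> V \<and> V \<subseteq> W \<and> smooth_fun_on C V f"
  shows "smooth_fun_on C W f"
proof -
  obtain V where V: "\<And>p. p \<in> W \<Longrightarrow> open (V p) \<and> p \<in> V p \<and> V p \<subseteq> W \<and> smooth_fun_on C (V p) f"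
    using assms by metis
  have "(\<Union>p\<in>W. V p) = W" using V by blast
  moreover have "smooth_fun_on C (\<Union>p\<in>W. V p) f"
    by (rule smooth_fun_on_UN) (use V in blast)+
  ultimately show ?thesis by simp
qed

lemma smooth_fun_on_Un:
  "open V \<Longrightarrow> open W \<Longrightarrow> smooth_fun_on C V f \<Longrightarrow> smooth_fun_on C W f \<Longrightarrow> smooth_fun_on C (V \<union> W) f"
  using smooth_fun_on_UN[of "{V, W}" "\<lambda>X. X" f] by auto

lemma smooth_fun_on_const: "smooth_fun_on C W (\<lambda>q. c)"
  by (simp add: smooth_fun_on_def smooth_on_const comp_def)

lemma smooth_fun_on_add:
  assumes "open W" "smooth_fun_on C W f" "smooth_fun_on C W g"
  shows "smooth_fun_on C W (\<lambda>q. f q + g q)"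
  by (rule smooth_fun_onI[OF _ assms(1)])
    (rule smooth_on_add[OF _ smooth_fun_onD[OF assms(2)] smooth_fun_onD[OF assms(3)]])

lemma smooth_fun_on_mult:
  assumes "open W" "smooth_fun_on C W f" "smooth_fun_on C W g"
  shows "smooth_fun_on C W (\<lambda>q. f q * g q)"
  by (rule smooth_fun_onI[OF _ assms(1)])
    (rule smooth_on_mult[OF _ smooth_fun_onD[OF assms(2)] smooth_fun_onD[OF assms(3)]])

lemma smooth_fun_on_uminus:
  "open W \<Longrightarrow> smooth_fun_on C W f \<Longrightarrow> smooth_fun_on C W (\<lambda>q. - f q)"
  using smooth_fun_on_mult[OF _ smooth_fun_on_const[of _ "-1"], of W f] by simp

lemma smooth_fun_on_diff:
  "open W \<Longrightarrow> smooth_fun_on C W f \<Longrightarrow> smooth_fun_on C W g \<Longrightarrow> smooth_fun_on C W (\<lambda>q. f q - g q)"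
  using smooth_fun_on_add[OF _ _ smooth_fun_on_uminus, of W f g] by simp

lemma smooth_fun_on_inverse:
  assumes "open W" "smooth_fun_on C W f" "\<And>q. q \<in> W \<Longrightarrow> f q \<noteq> 0"
  shows "smooth_fun_on C W (\<lambda>q. inverse (f q))"
proof (rule smooth_fun_onI[OF _ assms(1)])
  fix U \<psi> assume U: "(U, \<psi>) \<in> C" and o: "open (\<psi> ` (U \<inter> W))"
  show "smooth_on (\<psi> ` (U \<inter> W)) (\<lambda>y. inverse (f (inv_into U \<psi> y)))"
    by (rule smooth_on_inverse[OF o smooth_fun_onD[OF assms(2) U]]) (use U assms(3) in auto)
qed

lemma smooth_fun_on_divide:
  "open W \<Longrightarrow> smooth_fun_on C W f \<Longrightarrow> smooth_fun_on C W g \<Longrightarrow> (\<And>q. q \<in> W \<Longrightarrow> g q \<noteq> 0)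
    \<Longrightarrow> smooth_fun_on C W (\<lambda>q. f q / g q)"
  unfolding divide_inverse by (intro smooth_fun_on_mult smooth_fun_on_inverse)

lemma smooth_fun_on_sum:
  "open W \<Longrightarrow> (\<And>i. i \<in> I \<Longrightarrow> smooth_fun_on C W (f i)) \<Longrightarrow> smooth_fun_on C W (\<lambda>q. \<Sum>i\<in>I. f i q)"
  by (induction I rule: infinite_finite_induct)
    (simp_all add: smooth_fun_on_add smooth_fun_on_const)

lemma smooth_fun_on_prod:
  "open W \<Longrightarrow> (\<And>i. i \<in> I \<Longrightarrow> smooth_fun_on C W (f i)) \<Longrightarrow> smooth_fun_on C W (\<lambda>q. \<Prod>i\<in>I. f i q)"
  by (induction I rule: infinite_finite_induct)
    (simp_all add: smooth_fun_on_mult smooth_fun_on_const)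

text \<open>\<open>W\<close> is the union of \<open>W \<inter> U\<close> and \<open>W - K\<close>;
  closedness of \<open>K\<close> makes the second set open, and the extension is 0 on it.\<close>

lemma smooth_fun_on_extend_zero:
  assumes "open W" "open U" "closed K" "K \<subseteq> U" "smooth_fun_on C (W \<inter> U) f"
    "\<And>q. q \<in> U \<Longrightarrow> q \<notin> K \<Longrightarrow> f q = 0"
  shows "smooth_fun_on C W (\<lambda>q. if q \<in> U then f q else 0)"
proof -
  have "smooth_fun_on C (W \<inter> U \<union> (W - K)) (\<lambda>q. if q \<in> U then f q else 0)"
  proof (rule smooth_fun_on_Un)
    show "smooth_fun_on C (W \<inter> U) (\<lambda>q. if q \<in> U then f q else 0)"
      by (rule smooth_fun_on_cong[OF _ assms(5)]) (use assms in auto)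
    show "smooth_fun_on C (W - K) (\<lambda>q. if q \<in> U then f q else 0)"
      by (rule smooth_fun_on_cong[OF _ smooth_fun_on_const[of _ 0]]) (use assms in auto)
  qed (use assms in auto)
  moreover have "W \<inter> U \<union> (W - K) = W" using assms(4) by blast
  ultimately show ?thesis by simp
qed

text \<open>Compactness of the support in the chart is what makes it closed in the (Hausdorff) manifold.\<close>

lemma bump_function:
  assumes "open W" "p \<in> W"
  obtains \<eta> K where "smooth_fun_on C UNIV \<eta>" "\<eta> p \<noteq> 0" "closed K" "K \<subseteq> W"
    "\<forall>q. q \<notin> K \<longrightarrow> \<eta> q = 0"
proof -
  obtain U \<psi> where U: "(U, \<psi>) \<in> C" "p \<in> U" by (rule chart_at)
  have "open (\<psi> ` (U \<inter> W))" "\<psi> p \<in> \<psi> ` (U \<inter> W)"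
    using open_chart_image U assms by auto
  then obtain e where e: "e > 0" "ball (\<psi> p) e \<subseteq> \<psi> ` (U \<inter> W)"
    using open_contains_ball by blast
  obtain S where "finite S" "span S = (UNIV :: 'e set)"
    using atlas by (auto simp: smooth_atlas_def)
  then obtain d K where K: "d > 0" "compact K" "ball (\<psi> p) d \<subseteq> K" "K \<subseteq> ball (\<psi> p) e"
    using ball_subset_compact_subset_ball e(1) by blast
  \<comment> \<open>Positive exactly on the ball of radius \<open>d\<close> about
    \<open>\<psi> p\<close>. The squared norm appears as an inner product, to which the bilinear
    rule applies.\<close>
  define g where "g y = flat 0 (d\<^sup>2 + - 1 * inner (y - \<psi> p) (y - \<psi> p))" for y
  define \<eta> where "\<eta> q = (if q \<in> U then g (\<psi> q) else 0)" for q
  define L where "L = inv_into U \<psi> ` K"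
  have KU: "K \<subseteq> \<psi> ` (U \<inter> W)" using K(4) e(2) by blast
  have "continuous_on K (inv_into U \<psi>)"
    using chart(3)[OF U(1)] KU by (auto simp: homeomorphism_def elim!: continuous_on_subset)
  then have L: "closed L" "L \<subseteq> U \<inter> W"
    using K(2) KU U(1) by (auto simp: L_def intro!: compact_imp_closed compact_continuous_image)
  have outside: "\<eta> q = 0" if "q \<notin> L" for q
  proof (rule ccontr)
    assume "\<eta> q \<noteq> 0"
    then have q: "q \<in> U" "d\<^sup>2 > (norm (\<psi> q - \<psi> p))\<^sup>2"
      by (auto simp: \<eta>_def g_def flat_def dot_square_norm split: if_splits)
    then have "\<psi> q \<in> K"
      using K(1,3) power_less_imp_less_base[of "norm (\<psi> q - \<psi> p)" 2 d]
      by (auto simp: dist_norm norm_minus_commute)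
    then show False
      using that q(1) chart_inv[OF U(1) q(1)] image_eqI[of q "inv_into U \<psi>" "\<psi> q" K]
      by (simp add: L_def)
  qed
  \<comment> \<open>Read in another chart, \<open>\<psi>\<close> becomes a transition map, which is
    smooth.\<close>
  have "smooth_fun_on C (UNIV \<inter> U) (\<lambda>q. g (\<psi> q))"
  proof (rule smooth_fun_onI)
    fix U' \<psi>' assume U': "(U', \<psi>') \<in> C" and o: "open (\<psi>' ` (U' \<inter> (UNIV \<inter> U)))"
    let ?t = "\<lambda>y. \<psi> (inv_into U' \<psi>' y) + - \<psi> p"
    have t: "smooth_on (\<psi>' ` (U' \<inter> (UNIV \<inter> U))) ?t"
      using chart_transition[OF U' U(1)] o by (intro smooth_on_add smooth_on_const) (auto simp: comp_def)
    show "smooth_on (\<psi>' ` (U' \<inter> (UNIV \<inter> U))) (\<lambda>y. g (\<psi> (inv_into U' \<psi>' y)))"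
      unfolding g_def diff_conv_add_uminus
      by (intro smooth_on_compose_real[OF o _ smooth_on_flat[of 0]] smooth_on_add[OF o]
          smooth_on_mult[OF o] smooth_on_const smooth_on_bilinear[OF bounded_bilinear_inner o t t])
        auto
  qed (use chart(1) U(1) in auto)
  moreover have "g (\<psi> q) = 0" if "q \<in> U" "q \<notin> L" for q
    using outside[OF that(2)] that(1) by (simp add: \<eta>_def)
  ultimately have "smooth_fun_on C UNIV \<eta>"
    unfolding \<eta>_def
    by (intro smooth_fun_on_extend_zero[of UNIV U L]) (use chart(1) U(1) L in auto)
  moreover have "\<eta> p \<noteq> 0"
    using U(2) K(1) by (simp add: \<eta>_def g_def flat_def)
  ultimately show thesis
    using that L outside by blast
qed

text \<open>Makes the set where a bump function is nonzero open, so that it can be divided by on a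
  neighbourhood.\<close>

lemma smooth_fun_on_continuous:
  assumes "open W" "smooth_fun_on C W f"
  shows "continuous_on W f"
proof -
  have "continuous_on (\<Union>(U, \<psi>)\<in>C. U \<inter> W) f"
  proof (rule continuous_on_open_UN, unfold split_def)
    fix c assume "c \<in> C"
    then have c: "(fst c, snd c) \<in> C" by simp
    show "open (fst c \<inter> W)" using chart(1)[OF c] assms(1) by auto
    have "continuous_on (snd c ` (fst c \<inter> W)) (\<lambda>y. f (inv_into (fst c) (snd c) y))"
      using smooth_fun_onD[OF assms(2) c, unfolded smooth_on_def, THEN spec, of 0] by simp
    moreover have "continuous_on (fst c \<inter> W) (snd c)"
      using chart(3)[OF c] by (auto simp: homeomorphism_def elim: continuous_on_subset)
    ultimately have "continuous_on (fst c \<inter> W) (\<lambda>q. f (inv_into (fst c) (snd c) (snd c q)))"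
      by (rule continuous_on_compose2) simp
    then show "continuous_on (fst c \<inter> W) f"
      by (rule continuous_on_cong[THEN iffD1, rotated -1]) (use c in auto)
  qed
  moreover have "(\<Union>(U, \<psi>)\<in>C. U \<inter> W) = W"
    using atlas unfolding smooth_atlas_def by blast
  ultimately show ?thesis by simp
qed

section \<open>Determinants and linear systems with smooth coefficients\<close>

lemma smooth_fun_on_det:
  assumes "open W" "\<And>i j. i < n \<Longrightarrow> j < n \<Longrightarrow> smooth_fun_on C W (a i j)"
  shows "smooth_fun_on C W (\<lambda>q. det (mat n n (\<lambda>(i, j). a i j q)))"
proof -
  have "smooth_fun_on C W (\<lambda>q. \<Sum>\<pi> | \<pi> permutes {0..<n}. signof \<pi> * (\<Prod>i = 0..<n. a i (\<pi> i) q))"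
    using permutes_in_image
    by (intro smooth_fun_on_sum smooth_fun_on_mult smooth_fun_on_const smooth_fun_on_prod assms)
      fastforce+
  moreover have "det (mat n n (\<lambda>(i, j). a i j q)) =
      (\<Sum>\<pi> | \<pi> permutes {0..<n}. signof \<pi> * (\<Prod>i = 0..<n. a i (\<pi> i) q))" for q
    by (subst det_def'[of _ n])
      (auto intro!: sum.cong prod.cong simp: permutes_in_image[of _ "{0..<n}", simplified])
  ultimately show ?thesis by presburger
qed

text \<open>Cramer's rule: the solution is a quotient of determinants.\<close>

lemma smooth_linear_system_solution:
  fixes a :: "nat \<Rightarrow> nat \<Rightarrow> 'm \<Rightarrow> real"
  assumes W: "open W"
    and a: "\<And>i j. i < n \<Longrightarrow> j < n \<Longrightarrow> smooth_fun_on C W (a i j)"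
    and d: "\<And>i. i < n \<Longrightarrow> smooth_fun_on C W (d i)"
    and solution: "\<And>q i. q \<in> W \<Longrightarrow> i < n \<Longrightarrow> (\<Sum>j<n. a i j q * c j q) = d i q"
    and unique: "\<And>q v. q \<in> W \<Longrightarrow> \<forall>i<n. (\<Sum>j<n. a i j q * v j) = 0 \<Longrightarrow> \<forall>j<n. v j = 0"
    and k: "k < n"
  shows "smooth_fun_on C W (c k)"
proof -
  define M where "M q = mat n n (\<lambda>(i, j). a i j q)" for q
  have M: "M q \<in> carrier_mat n n" for q by (simp add: M_def)
  have det: "det (M q) \<noteq> 0" if q: "q \<in> W" for q
  proof
    assume "det (M q) = 0"
    then obtain v where v: "v \<in> carrier_vec n" "v \<noteq> 0\<^sub>v n" "M q *\<^sub>v v = 0\<^sub>v n"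
      using det_0_iff_vec_prod_zero[OF M] by blast
    have "(\<Sum>j<n. a i j q * vec_index v j) = vec_index (M q *\<^sub>v v) i" if "i < n" for i
      using that v(1) by (auto simp: M_def scalar_prod_def lessThan_atLeast0 intro!: sum.cong)
    then have "\<forall>j<n. vec_index v j = 0" using unique[OF q, of "\<lambda>j. vec_index v j"] v(3) by auto
    then show False using v(1,2) by auto
  qed
  have cofactor: "smooth_fun_on C W (\<lambda>q. cofactor (M q) i k)" if i: "i < n" for i
  proof -
    \<comment> \<open>\<open>?s m\<close> enumerates the indices other than \<open>m\<close>, so the
      minor without row \<open>i\<close> and column \<open>k\<close> is again a matrix of smooth
      coefficients.\<close>
    let ?s = "\<lambda>m j. if j < m then j else Suc j"
    have "mat_delete (M q) i k = mat (n - 1) (n - 1) (\<lambda>(i', j'). a (?s i i') (?s k j') q)" for q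
      using i k by (auto simp: mat_delete_def M_def intro!: eq_matI)
    then show ?thesis
      unfolding cofactor_def
      by (auto intro!: smooth_fun_on_mult smooth_fun_on_const smooth_fun_on_det W a)
  qed
  have "c k q = (\<Sum>i<n. cofactor (M q) i k * d i q) / det (M q)" if q: "q \<in> W" for q
  proof -
    let ?c = "Matrix.vec n (\<lambda>j. c j q)"
    have d: "M q *\<^sub>v ?c = Matrix.vec n (\<lambda>i. d i q)"
    proof (rule eq_vecI)
      fix i assume "i < dim_vec (Matrix.vec n (\<lambda>i. d i q))"
      then have i: "i < n" by simp
      then have "vec_index (M q *\<^sub>v ?c) i = (\<Sum>j<n. a i j q * c j q)"
        by (auto simp: M_def scalar_prod_def lessThan_atLeast0 intro!: sum.cong)
      then show "vec_index (M q *\<^sub>v ?c) i = vec_index (Matrix.vec n (\<lambda>i. d i q)) i" using solution[OF q i] i by simp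
    qed (use M in auto)
    \<comment> \<open>The adjugate times the matrix is the determinant times the identity, so row
      \<open>k\<close> of the multiplied system isolates \<open>c k q\<close>.\<close>
    have "adj_mat (M q) *\<^sub>v (M q *\<^sub>v ?c) = (adj_mat (M q) * M q) *\<^sub>v ?c"
      by (rule assoc_mult_mat_vec[OF adj_mat(1)[OF M] M, symmetric]) simp
    moreover have "vec_index (adj_mat (M q) * M q *\<^sub>v ?c) k = det (M q) * c k q"
      unfolding adj_mat(3)[OF M] using k
      by (simp add: scalar_prod_def if_distrib[of "\<lambda>t. _ * t * _"] cong: if_cong)
    ultimately have "vec_index (adj_mat (M q) *\<^sub>v Matrix.vec n (\<lambda>i. d i q)) k = det (M q) * c k q"
      unfolding d by simp
    moreover have "vec_index (adj_mat (M q) *\<^sub>v Matrix.vec n (\<lambda>i. d i q)) k = (\<Sum>i<n. cofactor (M q) i k * d i q)"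
      using k M[of q] by (auto simp: adj_mat_def scalar_prod_def lessThan_atLeast0 intro!: sum.cong)
    ultimately show ?thesis using det[OF q] by (simp add: field_simps)
  qed
  moreover have "smooth_fun_on C W (\<lambda>q. det (M q))"
    unfolding M_def by (rule smooth_fun_on_det[OF W a])
  then have "smooth_fun_on C W (\<lambda>q. (\<Sum>i<n. cofactor (M q) i k * d i q) / det (M q))"
    using det by (intro smooth_fun_on_divide W smooth_fun_on_sum smooth_fun_on_mult cofactor d) auto
  ultimately show ?thesis
    by (intro smooth_fun_on_cong[OF W, of _ "c k"]) auto
qed

end

section \<open>Smooth vector bundles\<close>

locale smooth_bundle =
  fixes A :: "('m::{t2_space,second_countable_topology}, 'e::real_inner, 'f::real_vector) algebroid"
  assumes vector_bundle: "smooth_vector_bundle A"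

sublocale smooth_bundle \<subseteq> smooth_manifold "charts A"
  using vector_bundle by unfold_locales (simp add: smooth_vector_bundle_def)

context smooth_bundle
begin

abbreviation smooth :: "'m set \<Rightarrow> ('m \<Rightarrow> real) \<Rightarrow> bool" where
  "smooth \<equiv> smooth_fun_on (charts A)"

lemma subspace_fibre: "subspace (fibre A p)"
  using vector_bundle by (simp add: smooth_vector_bundle_def)

lemmas fibre_add = subspace_add[OF subspace_fibre]
lemmas fibre_diff = subspace_diff[OF subspace_fibre]
lemmas fibre_scale = subspace_scale[OF subspace_fibre]
lemmas fibre_zero = subspace_0[OF subspace_fibre]
lemmas fibre_sum = subspace_sum[OF subspace_fibre]

lemma triv_open: "(U, r, \<phi>) \<in> trivs A \<Longrightarrow> open U"
  using vector_bundle by (auto simp: smooth_vector_bundle_def)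

lemma triv_at:
  obtains U r \<phi> where "(U, r, \<phi>) \<in> trivs A" "p \<in> U"
proof -
  have "(\<Union>(U, r, \<phi>)\<in>trivs A. U) = UNIV"
    using vector_bundle by (simp add: smooth_vector_bundle_def)
  then have "p \<in> (\<Union>(U, r, \<phi>)\<in>trivs A. U)" by simp
  then show thesis using that by auto
qed

lemma triv_fibre:
  assumes "(U, r, \<phi>) \<in> trivs A" "q \<in> U"
  shows "bij_betw (\<phi> q) (fibre A q) {c. \<forall>i\<ge>r. c i = 0}"
    "\<forall>v\<in>fibre A q. \<forall>w\<in>fibre A q. \<forall>i. \<phi> q (v + w) i = \<phi> q v i + \<phi> q w i"
    "\<forall>v\<in>fibre A q. \<forall>c i. \<phi> q (c *\<^sub>R v) i = c * \<phi> q v i"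
proof -
  have "\<forall>(U, r, \<phi>)\<in>trivs A. \<forall>q\<in>U. bij_betw (\<phi> q) (fibre A q) {c. \<forall>i\<ge>r. c i = 0} \<and>
      (\<forall>v\<in>fibre A q. \<forall>w\<in>fibre A q. \<forall>i. \<phi> q (v + w) i = \<phi> q v i + \<phi> q w i) \<and>
      (\<forall>v\<in>fibre A q. \<forall>c i. \<phi> q (c *\<^sub>R v) i = c * \<phi> q v i)"
    using vector_bundle unfolding smooth_vector_bundle_def by fast
  from bspec[OF this assms(1)] assms(2)
  show "bij_betw (\<phi> q) (fibre A q) {c. \<forall>i\<ge>r. c i = 0}"
    "\<forall>v\<in>fibre A q. \<forall>w\<in>fibre A q. \<forall>i. \<phi> q (v + w) i = \<phi> q v i + \<phi> q w i"
    "\<forall>v\<in>fibre A q. \<forall>c i. \<phi> q (c *\<^sub>R v) i = c * \<phi> q v i"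
    by simp_all
qed

lemma triv_transition:
  assumes "(U, r, \<phi>) \<in> trivs A" "(U', r', \<phi>') \<in> trivs A" "j < r" "i < r'"
  shows "smooth (U \<inter> U') (\<lambda>q. \<phi>' q (frame A \<phi> j q) i)"
proof -
  have "\<forall>(U, r, \<phi>)\<in>trivs A. \<forall>(U', r', \<phi>')\<in>trivs A. \<forall>j<r. \<forall>i<r'.
        smooth (U \<inter> U') (\<lambda>q. \<phi>' q (frame A \<phi> j q) i)"
    using vector_bundle by (simp add: smooth_vector_bundle_def)
  from bspec[OF bspec[OF this assms(1), unfolded prod.case] assms(2)] assms(3,4)
  show ?thesis by simp
qed

text \<open>Linearity is required on the fibre only, values elsewhere being arbitrary. The codomain
  is any real vector space, so that covectors, coordinates, the anchor and bundle maps are treated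
  alike.\<close>

definition fibre_linear :: "'m \<Rightarrow> ('f \<Rightarrow> 'b::real_vector) \<Rightarrow> bool" where
  "fibre_linear p \<theta> \<longleftrightarrow> (\<forall>v\<in>fibre A p. \<forall>w\<in>fibre A p. \<theta> (v + w) = \<theta> v + \<theta> w) \<and>
     (\<forall>v\<in>fibre A p. \<forall>c. \<theta> (c *\<^sub>R v) = c *\<^sub>R \<theta> v)"

lemma fibre_linear_add:
  "fibre_linear p \<theta> \<Longrightarrow> v \<in> fibre A p \<Longrightarrow> w \<in> fibre A p \<Longrightarrow> \<theta> (v + w) = \<theta> v + \<theta> w"
  by (simp add: fibre_linear_def)

lemma fibre_linear_scale: "fibre_linear p \<theta> \<Longrightarrow> v \<in> fibre A p \<Longrightarrow> \<theta> (c *\<^sub>R v) = c *\<^sub>R \<theta> v"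
  by (simp add: fibre_linear_def)

lemma fibre_linear_zero: "fibre_linear p \<theta> \<Longrightarrow> \<theta> 0 = 0"
  using fibre_linear_scale[of p \<theta> 0 0] fibre_zero by simp

lemma fibre_linear_diff:
  assumes "fibre_linear p \<theta>" "v \<in> fibre A p" "w \<in> fibre A p"
  shows "\<theta> (v - w) = \<theta> v - \<theta> w"
  using fibre_linear_add[OF assms(1) fibre_diff[OF assms(2,3)] assms(3)] by simp

lemma fibre_linear_sum:
  assumes "fibre_linear p \<theta>" "\<And>i. i \<in> I \<Longrightarrow> v i \<in> fibre A p"
  shows "\<theta> (\<Sum>i\<in>I. c i *\<^sub>R v i) = (\<Sum>i\<in>I. c i *\<^sub>R \<theta> (v i))"
  using assms(2)
  by (induction I rule: infinite_finite_induct)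
    (simp_all add: fibre_linear_zero[OF assms(1)] fibre_linear_add[OF assms(1)] fibre_scale fibre_sum
      fibre_linear_scale[OF assms(1)])

lemma fibre_linear_component:
  "(U, r, \<phi>) \<in> trivs A \<Longrightarrow> q \<in> U \<Longrightarrow> fibre_linear q (\<lambda>v. \<phi> q v i)"
  using triv_fibre(2,3) by (simp add: fibre_linear_def)

lemma triv_component_zero:
  assumes "(U, r, \<phi>) \<in> trivs A" "q \<in> U" "v \<in> fibre A q" "i \<ge> r"
  shows "\<phi> q v i = 0"
  using bij_betwE[OF triv_fibre(1)[OF assms(1,2)]] assms(3,4) by simp

lemma frame:
  assumes "(U, r, \<phi>) \<in> trivs A" "q \<in> U" "j < r"
  shows "frame A \<phi> j q \<in> fibre A q" "\<phi> q (frame A \<phi> j q) i = (if i = j then 1 else 0)"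
proof -
  have "(\<lambda>i. if i = j then 1 else 0) \<in> \<phi> q ` fibre A q"
    using triv_fibre(1)[OF assms(1,2)] assms(3) by (simp add: bij_betw_def)
  from inv_into_into[OF this] f_inv_into_f[OF this]
  show "frame A \<phi> j q \<in> fibre A q" "\<phi> q (frame A \<phi> j q) i = (if i = j then 1 else 0)"
    by (simp_all add: frame_def)
qed

text \<open>\<open>\<phi> q\<close> is injective on the fibre, so comparing coordinates suffices;
  those of index at least \<open>r\<close> vanish on both sides.\<close>

lemma frame_expansion:
  assumes "(U, r, \<phi>) \<in> trivs A" "q \<in> U" "v \<in> fibre A q"
  shows "v = (\<Sum>j<r. \<phi> q v j *\<^sub>R frame A \<phi> j q)"
proof (rule inj_onD[OF bij_betw_imp_inj_on[OF triv_fibre(1)[OF assms(1,2)]]])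
  show "\<phi> q v = \<phi> q (\<Sum>j<r. \<phi> q v j *\<^sub>R frame A \<phi> j q)"
  proof
    fix i
    have "\<phi> q (\<Sum>j<r. \<phi> q v j *\<^sub>R frame A \<phi> j q) i =
        (\<Sum>j<r. \<phi> q v j *\<^sub>R \<phi> q (frame A \<phi> j q) i)"
      by (rule fibre_linear_sum[OF fibre_linear_component[OF assms(1,2)]])
        (simp add: frame(1)[OF assms(1,2)])
    also have "\<dots> = (\<Sum>j<r. if j = i then \<phi> q v j else 0)"
      by (intro sum.cong) (auto simp: frame(2)[OF assms(1,2)])
    finally show "\<phi> q v i = \<phi> q (\<Sum>j<r. \<phi> q v j *\<^sub>R frame A \<phi> j q) i"
      using triv_component_zero[OF assms, of i] by simp
  qed
  show "(\<Sum>j<r. \<phi> q v j *\<^sub>R frame A \<phi> j q) \<in> fibre A q"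
    by (intro fibre_sum fibre_scale frame(1)[OF assms(1,2)]) simp
qed (fact assms(3))

lemma fibre_linear_frame:
  assumes "(U, r, \<phi>) \<in> trivs A" "q \<in> U" "v \<in> fibre A q" "fibre_linear q \<theta>"
  shows "\<theta> v = (\<Sum>j<r. \<phi> q v j *\<^sub>R \<theta> (frame A \<phi> j q))"
proof -
  have "\<theta> v = \<theta> (\<Sum>j<r. \<phi> q v j *\<^sub>R frame A \<phi> j q)"
    using frame_expansion[OF assms(1-3)] by simp
  also have "\<dots> = (\<Sum>j<r. \<phi> q v j *\<^sub>R \<theta> (frame A \<phi> j q))"
    by (rule fibre_linear_sum[OF assms(4)]) (simp add: frame(1)[OF assms(1,2)])
  finally show ?thesis .
qed

section \<open>Global smooth functions and sections\<close>

lemma smooth_functionsI: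
  assumes "\<And>U r \<phi>. (U, r, \<phi>) \<in> trivs A \<Longrightarrow> smooth U f"
  shows "f \<in> smooth_functions A"
  unfolding smooth_functions_def
proof (intro CollectI smooth_fun_on_locally)
  fix p
  obtain U r \<phi> where U: "(U, r, \<phi>) \<in> trivs A" "p \<in> U" by (rule triv_at)
  then show "\<exists>V. open V \<and> p \<in> V \<and> V \<subseteq> UNIV \<and> smooth V f"
    using triv_open[OF U(1)] assms[OF U(1)] by (intro exI[of _ U]) simp
qed

lemma smooth_functionsD: "f \<in> smooth_functions A \<Longrightarrow> smooth U f"
  unfolding smooth_functions_def using smooth_fun_on_subset[of UNIV f U] by simp

lemma smooth_functions_uminus:
  "f \<in> smooth_functions A \<Longrightarrow> (\<lambda>p. - f p) \<in> smooth_functions A"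
  by (simp add: smooth_functions_def smooth_fun_on_uminus)

lemma smooth_functions_diff:
  "f \<in> smooth_functions A \<Longrightarrow> g \<in> smooth_functions A \<Longrightarrow> (\<lambda>p. f p - g p) \<in> smooth_functions A"
  by (simp add: smooth_functions_def smooth_fun_on_diff)

lemma smooth_functions_mult:
  "f \<in> smooth_functions A \<Longrightarrow> g \<in> smooth_functions A \<Longrightarrow> (\<lambda>p. f p * g p) \<in> smooth_functions A"
  by (simp add: smooth_functions_def smooth_fun_on_mult)

lemma sections_fibre: "x \<in> sections A \<Longrightarrow> x p \<in> fibre A p"
  by (simp add: sections_def)

lemma sections_component:
  assumes "x \<in> sections A" "(U, r, \<phi>) \<in> trivs A" "i < r"
  shows "smooth U (\<lambda>q. \<phi> q (x q) i)"
proof -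
  have "\<forall>(U, r, \<phi>)\<in>trivs A. \<forall>i<r. smooth U (\<lambda>q. \<phi> q (x q) i)"
    using assms(1) by (simp add: sections_def)
  from bspec[OF this assms(2)] assms(3) show ?thesis by simp
qed

lemma sectionsI:
  assumes "\<And>p. x p \<in> fibre A p"
    "\<And>U r \<phi> i. (U, r, \<phi>) \<in> trivs A \<Longrightarrow> i < r \<Longrightarrow> smooth U (\<lambda>q. \<phi> q (x q) i)"
  shows "x \<in> sections A"
  unfolding sections_def using assms by auto

lemma sections_add:
  assumes "x \<in> sections A" "y \<in> sections A"
  shows "(\<lambda>q. x q + y q) \<in> sections A"
proof (rule sectionsI)
  fix U r \<phi> i assume U: "(U, r, \<phi>) \<in> trivs A" "i < (r :: nat)"
  show "smooth U (\<lambda>q. \<phi> q (x q + y q) i)"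
    by (rule smooth_fun_on_cong[OF triv_open[OF U(1)] smooth_fun_on_add
          [OF triv_open[OF U(1)] sections_component[OF assms(1) U] sections_component[OF assms(2) U]]])
      (simp add: fibre_linear_add[OF fibre_linear_component[OF U(1)]] sections_fibre assms)
qed (simp add: fibre_add sections_fibre assms)

lemma sections_scale:
  assumes "f \<in> smooth_functions A" "x \<in> sections A"
  shows "(\<lambda>q. f q *\<^sub>R x q) \<in> sections A"
proof (rule sectionsI)
  fix U r \<phi> i assume U: "(U, r, \<phi>) \<in> trivs A" "i < (r :: nat)"
  show "smooth U (\<lambda>q. \<phi> q (f q *\<^sub>R x q) i)"
    by (rule smooth_fun_on_cong[OF triv_open[OF U(1)] smooth_fun_on_mult
          [OF triv_open[OF U(1)] smooth_functionsD[OF assms(1)] sections_component[OF assms(2) U]]])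
      (simp add: fibre_linear_scale[OF fibre_linear_component[OF U(1)]] sections_fibre assms)
qed (simp add: fibre_scale sections_fibre assms)

lemma const_smooth: "(\<lambda>q. c) \<in> smooth_functions A"
  by (simp add: smooth_functions_def smooth_fun_on_const)

lemma sections_diff:
  assumes "x \<in> sections A" "y \<in> sections A"
  shows "(\<lambda>q. x q - y q) \<in> sections A"
  using sections_add[OF assms(1) sections_scale[OF const_smooth[of "-1"] assms(2)]] by simp

lemma sections_zero: "(\<lambda>q. 0) \<in> sections A"
proof (rule sectionsI)
  fix U r \<phi> i assume U: "(U, r, \<phi>) \<in> trivs A" "i < (r :: nat)"
  show "smooth U (\<lambda>q. \<phi> q 0 i)"
    by (rule smooth_fun_on_cong[OF triv_open[OF U(1)] smooth_fun_on_const[of _ 0]])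
      (simp add: fibre_linear_zero[OF fibre_linear_component[OF U(1)]])
qed (simp add: fibre_zero)

lemma sections_sum:
  "(\<And>i. i \<in> I \<Longrightarrow> x i \<in> sections A) \<Longrightarrow> (\<lambda>q. \<Sum>i\<in>I. x i q) \<in> sections A"
  by (induction I rule: infinite_finite_induct) (simp_all add: sections_zero sections_add)

text \<open>In another trivialisation the components are \<open>\<eta>\<close> times those of the
  transition on the overlap, extended by zero.\<close>

lemma bump_frame_section:
  assumes U: "(U, r, \<phi>) \<in> trivs A" "j < r"
    and \<eta>: "smooth UNIV \<eta>" "closed K" "K \<subseteq> U" "\<forall>q. q \<notin> K \<longrightarrow> \<eta> q = 0"
  shows "(\<lambda>q. if q \<in> U then \<eta> q *\<^sub>R frame A \<phi> j q else 0) \<in> sections A"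
proof (rule sectionsI)
  show "(if q \<in> U then \<eta> q *\<^sub>R frame A \<phi> j q else 0) \<in> fibre A q" for q
    using frame(1)[OF U(1) _ U(2)] by (simp add: fibre_zero fibre_scale)
next
  fix U' r' \<phi>' i assume U': "(U', r', \<phi>') \<in> trivs A" "i < (r' :: nat)"
  note o = triv_open[OF U'(1)] triv_open[OF U(1)]
  have "smooth (U' \<inter> U) (\<lambda>q. \<eta> q * \<phi>' q (frame A \<phi> j q) i)"
    using o smooth_fun_on_subset[OF \<eta>(1)] triv_transition[OF U(1) U'(1) U(2) U'(2)]
    by (intro smooth_fun_on_mult) (auto simp: Int_commute)
  then have "smooth U' (\<lambda>q. if q \<in> U then \<eta> q * \<phi>' q (frame A \<phi> j q) i else 0)"
    by (rule smooth_fun_on_extend_zero[OF o \<eta>(2,3)]) (simp add: \<eta>(4))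
  then show "smooth U' (\<lambda>q. \<phi>' q (if q \<in> U then \<eta> q *\<^sub>R frame A \<phi> j q else 0) i)"
    by (rule smooth_fun_on_cong[OF o(1)])
      (simp add: fibre_linear_zero[OF fibre_linear_component[OF U'(1)]]
        fibre_linear_scale[OF fibre_linear_component[OF U'(1)] frame(1)[OF U(1) _ U(2)]])
qed

text \<open>The passage from identities between sections to identities in a fibre rests on this.
  Dividing the coordinates of \<open>v\<close> by \<open>\<eta> p\<close> undoes the factor of the
  bump function at \<open>p\<close>.\<close>

lemma section_through:
  assumes "v \<in> fibre A p"
  obtains x where "x \<in> sections A" "x p = v"
proof -
  obtain U r \<phi> where U: "(U, r, \<phi>) \<in> trivs A" "p \<in> U" by (rule triv_at)
  obtain \<eta> K where \<eta>: "smooth UNIV \<eta>" "\<eta> p \<noteq> 0" "closed K" "K \<subseteq> U" "\<forall>q. q \<notin> K \<longrightarrow> \<eta> q = 0"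
    by (rule bump_function[OF triv_open[OF U(1)] U(2)])
  define x where "x q = (\<Sum>j<r. (\<phi> p v j / \<eta> p) *\<^sub>R (if q \<in> U then \<eta> q *\<^sub>R frame A \<phi> j q else 0))" for q
  have "x \<in> sections A"
    unfolding x_def
    by (intro sections_sum sections_scale const_smooth bump_frame_section[OF U(1) _ \<eta>(1,3,4,5)]) auto
  moreover have "x p = v"
    using frame_expansion[OF U assms] U(2) \<eta>(2) by (simp add: x_def)
  ultimately show thesis by (rule that)
qed

section \<open>Sections of the dual bundle\<close>

lemma dual_fibre_linear: "\<alpha> \<in> dual_fibre A p \<Longrightarrow> fibre_linear p \<alpha>"
  by (simp add: dual_fibre_def fibre_linear_def)

lemma dual_fibre_outside: "\<alpha> \<in> dual_fibre A p \<Longrightarrow> v \<notin> fibre A p \<Longrightarrow> \<alpha> v = 0"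
  by (simp add: dual_fibre_def)

lemma dual_fibreI:
  "fibre_linear p \<theta> \<Longrightarrow> (\<lambda>v. if v \<in> fibre A p then \<theta> v else 0) \<in> dual_fibre A p"
  by (auto simp: dual_fibre_def fibre_linear_def fibre_add fibre_scale)

lemma dual_fibre_eqI:
  assumes "\<alpha> \<in> dual_fibre A p" "\<beta> \<in> dual_fibre A p" "\<And>v. v \<in> fibre A p \<Longrightarrow> \<alpha> v = \<beta> v"
  shows "\<alpha> = \<beta>"
proof
  fix v show "\<alpha> v = \<beta> v"
    using assms(3) dual_fibre_outside[OF assms(1)] dual_fibre_outside[OF assms(2)]
    by (cases "v \<in> fibre A p") auto
qed

text \<open>The basis dual to the local frame. Extended by zero it lies in
  \<open>dual_fibre\<close>, and it is the covector that occurs in the smoothness clause of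
  \<open>Sym2\<close>.\<close>

definition coframe :: "('m \<Rightarrow> 'f \<Rightarrow> nat \<Rightarrow> real) \<Rightarrow> nat \<Rightarrow> 'm \<Rightarrow> 'f \<Rightarrow> real" where
  "coframe \<phi> i q = (\<lambda>v. if v \<in> fibre A q then \<phi> q v i else 0)"

lemma coframe_in: "(U, r, \<phi>) \<in> trivs A \<Longrightarrow> q \<in> U \<Longrightarrow> coframe \<phi> i q \<in> dual_fibre A q"
  unfolding coframe_def by (rule dual_fibreI[OF fibre_linear_component])

lemma coframe_expansion:
  assumes "(U, r, \<phi>) \<in> trivs A" "q \<in> U" "\<alpha> \<in> dual_fibre A q"
  shows "\<alpha> = (\<lambda>v. \<Sum>j<r. \<alpha> (frame A \<phi> j q) * coframe \<phi> j q v)"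
proof
  fix v show "\<alpha> v = (\<Sum>j<r. \<alpha> (frame A \<phi> j q) * coframe \<phi> j q v)"
    using fibre_linear_frame[OF assms(1,2) _ dual_fibre_linear[OF assms(3)], of v]
      dual_fibre_outside[OF assms(3), of v]
    by (cases "v \<in> fibre A q") (simp_all add: coframe_def mult.commute)
qed

text \<open>Coordinates are covectors, so covectors separate the points of a fibre; this is the
  uniqueness behind the description in \<open>sharp\<close>.\<close>

lemma fibre_eqI:
  assumes "v \<in> fibre A p" "w \<in> fibre A p" "\<And>\<beta>. \<beta> \<in> dual_fibre A p \<Longrightarrow> \<beta> v = \<beta> w"
  shows "v = w"
proof -
  obtain U r \<phi> where U: "(U, r, \<phi>) \<in> trivs A" "p \<in> U" by (rule triv_at)
  have "\<phi> p v j = \<phi> p w j" for j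
    using assms(3)[OF coframe_in[OF U, of j]] assms(1,2) by (simp add: coframe_def)
  then show ?thesis
    using frame_expansion[OF U assms(1)] frame_expansion[OF U assms(2)] by simp
qed

lemma dual_sections_fibre: "\<alpha> \<in> dual_sections A \<Longrightarrow> \<alpha> p \<in> dual_fibre A p"
  by (simp add: dual_sections_def)

lemma dual_sections_linear: "\<alpha> \<in> dual_sections A \<Longrightarrow> fibre_linear p (\<alpha> p)"
  by (rule dual_fibre_linear[OF dual_sections_fibre])

lemma dual_sections_component:
  assumes "\<alpha> \<in> dual_sections A" "(U, r, \<phi>) \<in> trivs A" "j < r"
  shows "smooth U (\<lambda>q. \<alpha> q (frame A \<phi> j q))"
proof -
  have "\<forall>(U, r, \<phi>)\<in>trivs A. \<forall>j<r. smooth U (\<lambda>q. \<alpha> q (frame A \<phi> j q))"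
    using assms(1) by (simp add: dual_sections_def)
  from bspec[OF this assms(2)] assms(3) show ?thesis by simp
qed

lemma dual_sectionsI:
  assumes "\<And>p. \<alpha> p \<in> dual_fibre A p"
    "\<And>U r \<phi> j. (U, r, \<phi>) \<in> trivs A \<Longrightarrow> j < r \<Longrightarrow> smooth U (\<lambda>q. \<alpha> q (frame A \<phi> j q))"
  shows "\<alpha> \<in> dual_sections A"
  unfolding dual_sections_def using assms by auto

lemma pair_smooth:
  assumes "\<alpha> \<in> dual_sections A" "x \<in> sections A"
  shows "pair \<alpha> x \<in> smooth_functions A"
proof (rule smooth_functionsI)
  fix U r \<phi> assume U: "(U, r, \<phi>) \<in> trivs A"
  note o = triv_open[OF U]
  have s: "smooth U (\<lambda>q. \<Sum>j<r. \<phi> q (x q) j * \<alpha> q (frame A \<phi> j q))"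
    by (intro smooth_fun_on_sum[OF o] smooth_fun_on_mult[OF o] sections_component[OF assms(2) U]
        dual_sections_component[OF assms(1) U]) auto
  show "smooth U (pair \<alpha> x)"
    by (rule smooth_fun_on_cong[OF o s])
      (simp add: pair_def fibre_linear_frame[OF U _ sections_fibre[OF assms(2)]
          dual_sections_linear[OF assms(1)], symmetric] flip: real_scaleR_def)
qed

section \<open>Operators linear over the smooth functions\<close>

definition tensorial :: "(('m \<Rightarrow> 'f) \<Rightarrow> 'm \<Rightarrow> real) \<Rightarrow> bool" where
  "tensorial \<Phi> \<longleftrightarrow>
     (\<forall>x\<in>sections A. \<Phi> x \<in> smooth_functions A) \<and>
     (\<forall>x\<in>sections A. \<forall>y\<in>sections A. \<forall>p. \<Phi> (\<lambda>q. x q + y q) p = \<Phi> x p + \<Phi> y p) \<and>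
     (\<forall>f\<in>smooth_functions A. \<forall>x\<in>sections A. \<forall>p. \<Phi> (\<lambda>q. f q *\<^sub>R x q) p = f p * \<Phi> x p)"

lemma tensorialI:
  assumes "\<And>x. x \<in> sections A \<Longrightarrow> \<Phi> x \<in> smooth_functions A"
    "\<And>x y p. x \<in> sections A \<Longrightarrow> y \<in> sections A \<Longrightarrow> \<Phi> (\<lambda>q. x q + y q) p = \<Phi> x p + \<Phi> y p"
    "\<And>f x p. f \<in> smooth_functions A \<Longrightarrow> x \<in> sections A \<Longrightarrow> \<Phi> (\<lambda>q. f q *\<^sub>R x q) p = f p * \<Phi> x p"
  shows "tensorial \<Phi>"
  using assms by (simp add: tensorial_def)

lemma tensorial_smooth: "tensorial \<Phi> \<Longrightarrow> x \<in> sections A \<Longrightarrow> \<Phi> x \<in> smooth_functions A"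
  by (simp add: tensorial_def)

lemma tensorial_add:
  "tensorial \<Phi> \<Longrightarrow> x \<in> sections A \<Longrightarrow> y \<in> sections A \<Longrightarrow> \<Phi> (\<lambda>q. x q + y q) p = \<Phi> x p + \<Phi> y p"
  by (simp add: tensorial_def)

lemma tensorial_scale:
  "tensorial \<Phi> \<Longrightarrow> f \<in> smooth_functions A \<Longrightarrow> x \<in> sections A \<Longrightarrow>
     \<Phi> (\<lambda>q. f q *\<^sub>R x q) p = f p * \<Phi> x p"
  by (simp add: tensorial_def)

lemma tensorial_sum:
  assumes "tensorial \<Phi>" "\<And>i. i \<in> I \<Longrightarrow> f i \<in> smooth_functions A" "\<And>i. i \<in> I \<Longrightarrow> x i \<in> sections A"
  shows "\<Phi> (\<lambda>q. \<Sum>i\<in>I. f i q *\<^sub>R x i q) p = (\<Sum>i\<in>I. f i p * \<Phi> (x i) p)"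
proof -
  have zero: "\<Phi> (\<lambda>q. 0) p = 0"
    using tensorial_scale[OF assms(1) const_smooth[of 0] sections_zero] by simp
  show ?thesis
    using assms(2,3)
    by (induction I rule: infinite_finite_induct)
      (simp_all add: zero tensorial_add[OF assms(1)] tensorial_scale[OF assms(1)]
        sections_sum sections_scale)
qed

text \<open>Multiplying by \<open>\<eta>\<^sup>2\<close> turns the local frame expansion of a section into a global one.\<close>

lemma tensorial_eqI:
  assumes "tensorial \<Phi>" "x \<in> sections A" "y \<in> sections A" "x p = y p"
  shows "\<Phi> x p = \<Phi> y p"
proof -
  obtain U r \<phi> where U: "(U, r, \<phi>) \<in> trivs A" "p \<in> U" by (rule triv_at)
  note o = triv_open[OF U(1)]
  obtain \<eta> K where \<eta>: "smooth UNIV \<eta>" "\<eta> p \<noteq> 0" "closed K" "K \<subseteq> U" "\<forall>q. q \<notin> K \<longrightarrow> \<eta> q = 0"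
    by (rule bump_function[OF o U(2)])
  then have \<eta>': "\<eta> \<in> smooth_functions A" by (simp add: smooth_functions_def)
  define E where "E j q = (if q \<in> U then \<eta> q *\<^sub>R frame A \<phi> j q else 0)" for j q
  have E: "E j \<in> sections A" if "j < r" for j
    using bump_frame_section[OF U(1) that \<eta>(1,3,4,5)] by (simp add: E_def[abs_def])
  \<comment> \<open>On the right \<open>z\<close> enters only through its value at
    \<open>p\<close>.\<close>
  have *: "(\<eta> p * \<eta> p) * \<Phi> z p = (\<Sum>j<r. (\<eta> p * \<phi> p (z p) j) * \<Phi> (E j) p)" if z: "z \<in> sections A" for z
  proof -
    \<comment> \<open>One factor \<open>\<eta>\<close> makes the coefficient global, the other one
      the frame vector.\<close>
    define f where "f j q = (if q \<in> U then \<eta> q * \<phi> q (z q) j else 0)" for j q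
    have f: "f j \<in> smooth_functions A" if "j < r" for j
    proof -
      have "smooth (UNIV \<inter> U) (\<lambda>q. \<eta> q * \<phi> q (z q) j)"
        using smooth_fun_on_mult[OF o smooth_fun_on_subset[OF \<eta>(1)]
            sections_component[OF z U(1) that]] by simp
      then show ?thesis
        unfolding smooth_functions_def f_def
        by (intro CollectI smooth_fun_on_extend_zero[OF _ o \<eta>(3,4)]) (simp_all add: \<eta>(5))
    qed
    have "(\<eta> q * \<eta> q) *\<^sub>R z q = (\<Sum>j<r. f j q *\<^sub>R E j q)" for q
    proof (cases "q \<in> U")
      case True
      have "(\<eta> q * \<eta> q) *\<^sub>R z q = (\<eta> q * \<eta> q) *\<^sub>R (\<Sum>j<r. \<phi> q (z q) j *\<^sub>R frame A \<phi> j q)"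
        using frame_expansion[OF U(1) True sections_fibre[OF z]] by simp
      then show ?thesis
        using True by (simp add: f_def E_def scaleR_sum_right mult_ac)
    next
      case False
      then have "\<eta> q = 0" using \<eta>(4,5) by blast
      then show ?thesis using False by (simp add: f_def)
    qed
    then have "\<Phi> (\<lambda>q. (\<eta> q * \<eta> q) *\<^sub>R z q) p = (\<Sum>j<r. f j p * \<Phi> (E j) p)"
      using tensorial_sum[OF assms(1), of "{..<r}" f E] f E by simp
    then show ?thesis
      using tensorial_scale[OF assms(1) smooth_functions_mult[OF \<eta>' \<eta>'] z] U(2) by (simp add: f_def)
  qed
  have "(\<eta> p * \<eta> p) * \<Phi> x p = (\<eta> p * \<eta> p) * \<Phi> y p"
    unfolding *[OF assms(2)] *[OF assms(3)] assms(4) ..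
  then show ?thesis using \<eta>(2) by simp
qed

lemma tensorial_dual_section:
  assumes "tensorial \<Phi>"
  obtains \<theta> where "\<theta> \<in> dual_sections A" "\<forall>y\<in>sections A. \<forall>p. pair \<theta> y p = \<Phi> y p"
proof -
  \<comment> \<open>The covector at \<open>p\<close> is evaluated on \<open>v\<close> by applying
    \<open>\<Phi>\<close> to some section through \<open>v\<close>; \<open>tensorial_eqI\<close>
    makes the choice immaterial, hence the values additive.\<close>
  define s where "s p v = (SOME x. x \<in> sections A \<and> x p = v)" for p v
  have s: "s p v \<in> sections A \<and> s p v p = v" if v: "v \<in> fibre A p" for p v
  proof -
    obtain x where "x \<in> sections A" "x p = v" by (rule section_through[OF v])
    then show ?thesis
      unfolding s_def using someI[of "\<lambda>x. x \<in> sections A \<and> x p = v" x] by simp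
  qed
  define \<theta> where "\<theta> p v = (if v \<in> fibre A p then \<Phi> (s p v) p else 0)" for p v
  have \<theta>: "\<theta> p (y p) = \<Phi> y p" if "y \<in> sections A" for y p
    using tensorial_eqI[OF assms _ that, of "s p (y p)" p] s[OF sections_fibre[OF that]] that
    by (simp add: \<theta>_def sections_fibre)
  have "\<theta> p \<in> dual_fibre A p" for p
  proof -
    have "fibre_linear p (\<theta> p)"
      unfolding fibre_linear_def
    proof (intro conjI ballI allI)
      fix v w assume vw: "v \<in> fibre A p" "w \<in> fibre A p"
      show "\<theta> p (v + w) = \<theta> p v + \<theta> p w"
        using \<theta>[OF sections_add, of "s p v" "s p w" p] \<theta>[of "s p v" p] \<theta>[of "s p w" p]
          tensorial_add[OF assms, of "s p v" "s p w" p] s[OF vw(1)] s[OF vw(2)] by simp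
    next
      fix v c assume v: "v \<in> fibre A p"
      show "\<theta> p (c *\<^sub>R v) = c *\<^sub>R \<theta> p v"
        using \<theta>[OF sections_scale[OF const_smooth[of c], of "s p v"], of p] \<theta>[of "s p v" p]
          tensorial_scale[OF assms const_smooth[of c], of "s p v" p] s[OF v] by simp
    qed
    moreover have "(\<lambda>v. if v \<in> fibre A p then \<theta> p v else 0) = \<theta> p"
      by (simp add: \<theta>_def fun_eq_iff)
    ultimately show ?thesis
      using dual_fibreI[of p "\<theta> p"] by simp
  qed
  moreover have "smooth U (\<lambda>q. \<theta> q (frame A \<phi> j q))" if U: "(U, r, \<phi>) \<in> trivs A" "j < r" for U r \<phi> j
  proof (rule smooth_fun_on_locally)
    note o = triv_open[OF U(1)]
    fix p assume p: "p \<in> U"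
    obtain \<eta> K where \<eta>: "smooth UNIV \<eta>" "\<eta> p \<noteq> 0" "closed K" "K \<subseteq> U" "\<forall>q. q \<notin> K \<longrightarrow> \<eta> q = 0"
      by (rule bump_function[OF o p])
    define E where "E q = (if q \<in> U then \<eta> q *\<^sub>R frame A \<phi> j q else 0)" for q
    have E: "E \<in> sections A"
      using bump_frame_section[OF U \<eta>(1,3,4,5)] by (simp add: E_def[abs_def])
    define V where "V = {q \<in> U. \<eta> q \<noteq> 0}"
    have V: "open V"
    proof -
      have "V = U \<inter> \<eta> -` (- {0})" by (auto simp: V_def)
      moreover have "open (\<eta> -` (- {0}))"
        by (rule open_vimage[OF _ smooth_fun_on_continuous[OF open_UNIV \<eta>(1)]]) auto
      ultimately show ?thesis using o by (simp add: open_Int)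
    qed
    \<comment> \<open>The frame is only local, so \<open>\<Phi>\<close> is applied to
      \<open>\<eta>\<close> times the frame vector and the factor is divided out where it is
      nonzero.\<close>
    have "smooth V (\<lambda>q. \<Phi> E q / \<eta> q)"
      using smooth_fun_on_subset[OF \<eta>(1)] smooth_functionsD[OF tensorial_smooth[OF assms E]]
      by (intro smooth_fun_on_divide[OF V]) (auto simp: V_def)
    moreover have "\<Phi> E q / \<eta> q = \<theta> q (frame A \<phi> j q)" if "q \<in> V" for q
    proof -
      have q: "q \<in> U" "\<eta> q \<noteq> 0" using that by (auto simp: V_def)
      have "\<theta> q (E q) = \<eta> q * \<theta> q (frame A \<phi> j q)"
        using fibre_linear_scale[OF dual_fibre_linear[OF \<open>\<And>p. \<theta> p \<in> dual_fibre A p\<close>]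
            frame(1)[OF U(1) q(1) U(2)], of "\<eta> q"] q(1) by (simp add: E_def)
      then show ?thesis using \<theta>[OF E, of q] q(2) by (simp add: field_simps)
    qed
    ultimately have "smooth V (\<lambda>q. \<theta> q (frame A \<phi> j q))"
      by (rule smooth_fun_on_cong[OF V])
    then show "\<exists>V. open V \<and> p \<in> V \<and> V \<subseteq> U \<and> smooth V (\<lambda>q. \<theta> q (frame A \<phi> j q))"
      using V p \<eta>(2) by (intro exI[of _ V]) (auto simp: V_def)
  qed
  ultimately have "\<theta> \<in> dual_sections A" by (intro dual_sectionsI)
  then show thesis using that[of \<theta>] \<theta> by (simp add: pair_def)
qed

text \<open>A section passes through every vector, so the pairings with sections determine a
  covector; this uniqueness together with \<open>tensorial_dual_section\<close> justifies the
  definite description.\<close>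

lemma dual_section_of:
  assumes "tensorial \<Phi>"
  shows "dual_section_of A \<Phi> \<in> dual_sections A"
    "y \<in> sections A \<Longrightarrow> pair (dual_section_of A \<Phi>) y p = \<Phi> y p"
proof -
  let ?P = "\<lambda>\<theta>. \<theta> \<in> dual_sections A \<and> (\<forall>y\<in>sections A. \<forall>p. pair \<theta> y p = \<Phi> y p)"
  obtain \<theta> where "\<theta> \<in> dual_sections A" "\<forall>y\<in>sections A. \<forall>p. pair \<theta> y p = \<Phi> y p"
    by (rule tensorial_dual_section[OF assms])
  then have \<theta>: "?P \<theta>" by simp
  have "\<theta>' = \<theta>" if \<theta>': "?P \<theta>'" for \<theta>'
  proof
    fix p
    show "\<theta>' p = \<theta> p"
    proof (rule dual_fibre_eqI[of _ p])
      fix v assume "v \<in> fibre A p"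
      then obtain y where "y \<in> sections A" "y p = v" by (rule section_through)
      then show "\<theta>' p v = \<theta> p v" using \<theta> \<theta>' by (auto simp: pair_def)
    qed (use \<theta> \<theta>' dual_sections_fibre in auto)
  qed
  then have "?P (dual_section_of A \<Phi>)"
    unfolding dual_section_of_def by (rule theI[of ?P, OF \<theta>])
  then show "dual_section_of A \<Phi> \<in> dual_sections A"
    "y \<in> sections A \<Longrightarrow> pair (dual_section_of A \<Phi>) y p = \<Phi> y p" by simp_all
qed

section \<open>Bundle maps and symmetric forms\<close>

lemma Sym2_dual_sym: "B \<in> Sym2_dual A \<Longrightarrow> v \<in> fibre A p \<Longrightarrow> w \<in> fibre A p \<Longrightarrow> B p v w = B p w v"
  by (simp add: Sym2_dual_def)

lemma Sym2_dual_linear1: "B \<in> Sym2_dual A \<Longrightarrow> w \<in> fibre A p \<Longrightarrow> fibre_linear p (\<lambda>v. B p v w)"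
  by (simp add: Sym2_dual_def fibre_linear_def)

lemma Sym2_dual_linear2:
  assumes "B \<in> Sym2_dual A" "v \<in> fibre A p"
  shows "fibre_linear p (B p v)"
  using Sym2_dual_linear1[OF assms] Sym2_dual_sym[OF assms(1) assms(2)]
  by (simp add: fibre_linear_def fibre_add fibre_scale)

lemma Sym2_dual_smooth:
  assumes "B \<in> Sym2_dual A" "(U, r, \<phi>) \<in> trivs A" "i < r" "j < r"
  shows "smooth U (\<lambda>q. B q (frame A \<phi> i q) (frame A \<phi> j q))"
proof -
  have "\<forall>(U, r, \<phi>)\<in>trivs A. \<forall>i<r. \<forall>j<r. smooth U (\<lambda>q. B q (frame A \<phi> i q) (frame A \<phi> j q))"
    using assms(1) by (simp add: Sym2_dual_def)
  from bspec[OF this assms(2)] assms(3,4) show ?thesis by simp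
qed

lemma natmap_in:
  "B \<in> Sym2_dual A \<Longrightarrow> v \<in> fibre A p \<Longrightarrow> natmap A B p v \<in> dual_fibre A p"
  unfolding natmap_def by (rule dual_fibreI[OF Sym2_dual_linear2])

lemma natmap_apply: "w \<in> fibre A p \<Longrightarrow> natmap A B p v w = B p v w"
  by (simp add: natmap_def)

lemma natmap_section:
  assumes B: "B \<in> Sym2_dual A" and x: "x \<in> sections A"
  shows "app (natmap A B) x \<in> dual_sections A"
proof (rule dual_sectionsI)
  show "app (natmap A B) x p \<in> dual_fibre A p" for p
    by (simp add: app_def natmap_in[OF B sections_fibre[OF x]])
next
  fix U r \<phi> j assume U: "(U, r, \<phi>) \<in> trivs A" "j < (r :: nat)"
  note o = triv_open[OF U(1)]
  have s: "smooth U (\<lambda>q. \<Sum>i<r. \<phi> q (x q) i * B q (frame A \<phi> i q) (frame A \<phi> j q))"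
    by (intro smooth_fun_on_sum[OF o] smooth_fun_on_mult[OF o] sections_component[OF x U(1)]
        Sym2_dual_smooth[OF B U(1)]) (auto simp: U(2))
  show "smooth U (\<lambda>q. app (natmap A B) x q (frame A \<phi> j q))"
    by (rule smooth_fun_on_cong[OF o s])
      (simp add: app_def natmap_apply frame(1)[OF U(1) _ U(2)]
        fibre_linear_frame[OF U(1) _ sections_fibre[OF x] Sym2_dual_linear1[OF B]])
qed

lemma pair_natmap: "y \<in> sections A \<Longrightarrow> pair (app (natmap A B) x) y = ev B x y"
  by (simp add: pair_def app_def ev_def fun_eq_iff natmap_apply sections_fibre)

lemma dual_fibre_sum:
  assumes "\<And>j. j \<in> I \<Longrightarrow> \<beta> j \<in> dual_fibre A p"
  shows "(\<lambda>v. \<Sum>j\<in>I. c j * \<beta> j v) \<in> dual_fibre A p"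
proof -
  have "fibre_linear p (\<beta> j)" if "j \<in> I" for j
    by (rule dual_fibre_linear[OF assms[OF that]])
  then have "fibre_linear p (\<lambda>v. \<Sum>j\<in>I. c j * \<beta> j v)"
    by (simp add: fibre_linear_def sum.distrib sum_distrib_left algebra_simps)
  then show ?thesis
    using assms by (simp add: dual_fibre_def fibre_linear_def)
qed

section \<open>Symmetric tensors on covectors and the maps they induce\<close>

lemma Sym2_sym:
  "H \<in> Sym2 A \<Longrightarrow> \<alpha> \<in> dual_fibre A p \<Longrightarrow> \<beta> \<in> dual_fibre A p \<Longrightarrow> H p \<alpha> \<beta> = H p \<beta> \<alpha>"
  by (simp add: Sym2_def)

lemma Sym2_add:
  "H \<in> Sym2 A \<Longrightarrow> \<alpha> \<in> dual_fibre A p \<Longrightarrow> \<beta> \<in> dual_fibre A p \<Longrightarrow> \<gamma> \<in> dual_fibre A p \<Longrightarrow>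
     H p (\<lambda>v. \<alpha> v + \<beta> v) \<gamma> = H p \<alpha> \<gamma> + H p \<beta> \<gamma>"
  by (simp add: Sym2_def)

lemma Sym2_scale:
  "H \<in> Sym2 A \<Longrightarrow> \<alpha> \<in> dual_fibre A p \<Longrightarrow> \<gamma> \<in> dual_fibre A p \<Longrightarrow> H p (\<lambda>v. c * \<alpha> v) \<gamma> = c * H p \<alpha> \<gamma>"
  by (simp add: Sym2_def)

lemma Sym2_sum:
  assumes "H \<in> Sym2 A" "\<And>j. j \<in> I \<Longrightarrow> \<beta> j \<in> dual_fibre A p" "\<gamma> \<in> dual_fibre A p"
  shows "H p (\<lambda>v. \<Sum>j\<in>I. c j * \<beta> j v) \<gamma> = (\<Sum>j\<in>I. c j * H p (\<beta> j) \<gamma>)"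
  using assms(2)
proof (induction I rule: infinite_finite_induct)
  case (insert i I)
  have "(\<lambda>v. c i * \<beta> i v) \<in> dual_fibre A p"
    using dual_fibre_sum[of "{i}" \<beta> p c] insert.prems by simp
  moreover have "(\<lambda>v. \<Sum>j\<in>I. c j * \<beta> j v) \<in> dual_fibre A p"
    using insert.prems by (intro dual_fibre_sum) simp
  ultimately show ?case
    using Sym2_add[OF assms(1) _ _ assms(3), of "\<lambda>v. c i * \<beta> i v" "\<lambda>v. \<Sum>j\<in>I. c j * \<beta> j v"]
      Sym2_scale[OF assms(1) _ assms(3), of "\<beta> i" "c i"] insert by simp
\<comment> \<open>For empty and infinite sums: \<open>H\<close> vanishes at the zero covector,
  obtained as 0 times \<open>\<gamma>\<close>.\<close>
qed (use Sym2_scale[OF assms(1) assms(3) assms(3), of 0] in simp_all)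

lemma Sym2_smooth:
  assumes "H \<in> Sym2 A" "(U, r, \<phi>) \<in> trivs A" "i < r" "j < r"
  shows "smooth U (\<lambda>q. H q (coframe \<phi> i q) (coframe \<phi> j q))"
proof -
  have "\<forall>(U, r, \<phi>)\<in>trivs A. \<forall>i<r. \<forall>j<r. smooth U (\<lambda>q. H q (coframe \<phi> i q) (coframe \<phi> j q))"
    using assms(1) by (simp add: Sym2_def coframe_def)
  from bspec[OF this assms(2)] assms(3,4) show ?thesis by simp
qed

lemma sharp_eqI:
  assumes "v \<in> fibre A p" "\<And>\<beta>. \<beta> \<in> dual_fibre A p \<Longrightarrow> \<beta> v = H p \<alpha> \<beta>"
  shows "sharp A H p \<alpha> = v"
  unfolding sharp_def by (rule the_equality) (use assms fibre_eqI in auto)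

text \<open>A fibre has finite dimension, so the functional \<open>H p \<alpha>\<close> on covectors
  is evaluation at a vector: the one whose frame coefficients are the values of the functional on
  the coframe.\<close>

lemma sharp:
  assumes H: "H \<in> Sym2 A" and \<alpha>: "\<alpha> \<in> dual_fibre A p"
  shows "sharp A H p \<alpha> \<in> fibre A p"
    "\<beta> \<in> dual_fibre A p \<Longrightarrow> \<beta> (sharp A H p \<alpha>) = H p \<alpha> \<beta>"
proof -
  obtain U r \<phi> where U: "(U, r, \<phi>) \<in> trivs A" "p \<in> U" by (rule triv_at)
  let ?v = "\<Sum>i<r. H p \<alpha> (coframe \<phi> i p) *\<^sub>R frame A \<phi> i p"
  have v: "?v \<in> fibre A p"
    by (intro fibre_sum fibre_scale frame(1)[OF U]) simp
  have pairing: "\<beta> ?v = H p \<alpha> \<beta>" if \<beta>: "\<beta> \<in> dual_fibre A p" for \<beta>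
  proof -
    have "\<beta> ?v = (\<Sum>i<r. H p \<alpha> (coframe \<phi> i p) *\<^sub>R \<beta> (frame A \<phi> i p))"
      by (rule fibre_linear_sum[OF dual_fibre_linear[OF \<beta>]]) (simp add: frame(1)[OF U])
    also have "\<dots> = (\<Sum>i<r. \<beta> (frame A \<phi> i p) * H p (coframe \<phi> i p) \<alpha>)"
      by (intro sum.cong) (simp_all add: Sym2_sym[OF H \<alpha> coframe_in[OF U]])
    also have "\<dots> = H p (\<lambda>v. \<Sum>i<r. \<beta> (frame A \<phi> i p) * coframe \<phi> i p v) \<alpha>"
      by (rule Sym2_sum[OF H coframe_in[OF U] \<alpha>, symmetric])
    also have "\<dots> = H p \<alpha> \<beta>"
      using coframe_expansion[OF U \<beta>] Sym2_sym[OF H \<beta> \<alpha>] by simp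
    finally show ?thesis .
  qed
  have "sharp A H p \<alpha> = ?v" by (rule sharp_eqI[OF v]) (rule pairing)
  then show "sharp A H p \<alpha> \<in> fibre A p"
    "\<beta> \<in> dual_fibre A p \<Longrightarrow> \<beta> (sharp A H p \<alpha>) = H p \<alpha> \<beta>"
    using v pairing by simp_all
qed

lemma sharp_component:
  assumes H: "H \<in> Sym2 A" and U: "(U, r, \<phi>) \<in> trivs A" "q \<in> U" and \<alpha>: "\<alpha> \<in> dual_fibre A q"
  shows "\<phi> q (sharp A H q \<alpha>) i = (\<Sum>j<r. \<alpha> (frame A \<phi> j q) * H q (coframe \<phi> j q) (coframe \<phi> i q))"
proof -
  have "\<phi> q (sharp A H q \<alpha>) i = coframe \<phi> i q (sharp A H q \<alpha>)"
    using sharp(1)[OF H \<alpha>] by (simp add: coframe_def)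
  also have "\<dots> = H q (\<lambda>v. \<Sum>j<r. \<alpha> (frame A \<phi> j q) * coframe \<phi> j q v) (coframe \<phi> i q)"
    using sharp(2)[OF H \<alpha> coframe_in[OF U]] coframe_expansion[OF U \<alpha>] by simp
  also have "\<dots> = (\<Sum>j<r. \<alpha> (frame A \<phi> j q) * H q (coframe \<phi> j q) (coframe \<phi> i q))"
    by (rule Sym2_sum[OF H coframe_in[OF U] coframe_in[OF U]])
  finally show ?thesis .
qed

lemma sharp_section:
  assumes H: "H \<in> Sym2 A" and \<alpha>: "\<alpha> \<in> dual_sections A"
  shows "app (sharp A H) \<alpha> \<in> sections A"
proof (rule sectionsI)
  show "app (sharp A H) \<alpha> p \<in> fibre A p" for p
    by (simp add: app_def sharp(1)[OF H dual_sections_fibre[OF \<alpha>]])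
next
  fix U r \<phi> i assume U: "(U, r, \<phi>) \<in> trivs A" "i < (r :: nat)"
  note o = triv_open[OF U(1)]
  have s: "smooth U (\<lambda>q. \<Sum>j<r. \<alpha> q (frame A \<phi> j q) * H q (coframe \<phi> j q) (coframe \<phi> i q))"
    by (intro smooth_fun_on_sum[OF o] smooth_fun_on_mult[OF o] dual_sections_component[OF \<alpha> U(1)]
        Sym2_smooth[OF H U(1)]) (auto simp: U(2))
  show "smooth U (\<lambda>q. \<phi> q (app (sharp A H) \<alpha> q) i)"
    by (rule smooth_fun_on_cong[OF o s])
      (simp add: app_def sharp_component[OF H U(1) _ dual_sections_fibre[OF \<alpha>]])
qed

lemma ev_sharp:
  assumes H: "H \<in> Sym2 A" and "\<alpha> \<in> dual_sections A" "\<beta> \<in> dual_sections A"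
  shows "ev H \<alpha> \<beta> = pair \<beta> (app (sharp A H) \<alpha>)"
  using sharp(2)[OF H] assms(2,3) by (simp add: ev_def pair_def app_def fun_eq_iff dual_sections_fibre)

section \<open>Bundle maps\<close>

lemma bundle_map_in: "bundle_map A N \<Longrightarrow> v \<in> fibre A p \<Longrightarrow> N p v \<in> fibre A p"
  by (simp add: bundle_map_def)

lemma bundle_map_linear: "bundle_map A N \<Longrightarrow> fibre_linear p (N p)"
  by (simp add: bundle_map_def fibre_linear_def)

lemma bundle_map_smooth:
  assumes "bundle_map A N" "(U, r, \<phi>) \<in> trivs A" "i < r" "j < r"
  shows "smooth U (\<lambda>q. \<phi> q (N q (frame A \<phi> j q)) i)"
proof -
  have "\<forall>(U, r, \<phi>)\<in>trivs A. \<forall>i<r. \<forall>j<r. smooth U (\<lambda>q. \<phi> q (N q (frame A \<phi> j q)) i)"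
    using assms(1) by (simp add: bundle_map_def)
  from bspec[OF this assms(2)] assms(3,4) show ?thesis by simp
qed

lemma bundle_map_component:
  assumes N: "bundle_map A N" and U: "(U, r, \<phi>) \<in> trivs A" "q \<in> U" and v: "v \<in> fibre A q"
  shows "\<phi> q (N q v) i = (\<Sum>j<r. \<phi> q v j * \<phi> q (N q (frame A \<phi> j q)) i)"
proof -
  have "fibre_linear q (\<lambda>v. \<phi> q (N q v) i)"
    using bundle_map_linear[OF N] fibre_linear_component[OF U] bundle_map_in[OF N]
    by (simp add: fibre_linear_def)
  from fibre_linear_frame[OF U v this] show ?thesis by simp
qed

lemma bundle_map_section:
  assumes N: "bundle_map A N" and x: "x \<in> sections A"
  shows "app N x \<in> sections A"
proof (rule sectionsI)
  show "app N x p \<in> fibre A p" for p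
    by (simp add: app_def bundle_map_in[OF N sections_fibre[OF x]])
next
  fix U r \<phi> i assume U: "(U, r, \<phi>) \<in> trivs A" "i < (r :: nat)"
  note o = triv_open[OF U(1)]
  have s: "smooth U (\<lambda>q. \<Sum>j<r. \<phi> q (x q) j * \<phi> q (N q (frame A \<phi> j q)) i)"
    by (intro smooth_fun_on_sum[OF o] smooth_fun_on_mult[OF o] sections_component[OF x U(1)]
        bundle_map_smooth[OF N U(1)]) (auto simp: U(2))
  show "smooth U (\<lambda>q. \<phi> q (app N x q) i)"
    by (rule smooth_fun_on_cong[OF o s])
      (simp add: app_def bundle_map_component[OF N U(1) _ sections_fibre[OF x]])
qed

text \<open>Linearity is checked against covectors; in a frame the matrix of the composite is the
  product of those of \<open>B\<close> and \<open>H\<close>, hence smooth.\<close>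

lemma sharp_natmap_bundle_map:
  assumes B: "B \<in> Sym2_dual A" and H: "H \<in> Sym2 A"
  shows "bundle_map A (\<lambda>p v. sharp A H p (natmap A B p v))"
  unfolding bundle_map_def
proof (intro conjI allI ballI)
  fix p v assume v: "v \<in> fibre A p"
  show "sharp A H p (natmap A B p v) \<in> fibre A p"
    by (rule sharp(1)[OF H natmap_in[OF B v]])
  { fix w assume w: "w \<in> fibre A p"
    have "natmap A B p (v + w) = (\<lambda>u. natmap A B p v u + natmap A B p w u)"
      using fibre_linear_add[OF Sym2_dual_linear1[OF B] v w] by (simp add: natmap_def fun_eq_iff)
    then show "sharp A H p (natmap A B p (v + w)) =
        sharp A H p (natmap A B p v) + sharp A H p (natmap A B p w)"
      by (intro sharp_eqI)
        (simp_all add: fibre_add sharp[OF H natmap_in[OF B v]] sharp[OF H natmap_in[OF B w]]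
          Sym2_add[OF H natmap_in[OF B v] natmap_in[OF B w]] fibre_linear_add[OF dual_fibre_linear]) }
  fix c
  have "natmap A B p (c *\<^sub>R v) = (\<lambda>u. c * natmap A B p v u)"
    using fibre_linear_scale[OF Sym2_dual_linear1[OF B] v] by (simp add: natmap_def fun_eq_iff)
  then show "sharp A H p (natmap A B p (c *\<^sub>R v)) = c *\<^sub>R sharp A H p (natmap A B p v)"
    by (intro sharp_eqI)
      (simp_all add: fibre_scale sharp[OF H natmap_in[OF B v]]
        Sym2_scale[OF H natmap_in[OF B v]] fibre_linear_scale[OF dual_fibre_linear])
next
  have "smooth U (\<lambda>q. \<phi> q (sharp A H q (natmap A B q (frame A \<phi> j q))) i)"
    if U: "(U, r, \<phi>) \<in> trivs A" and ij: "i < r" "j < r" for U r \<phi> i j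
  proof -
    note o = triv_open[OF U]
    have s: "smooth U (\<lambda>q. \<Sum>k<r. B q (frame A \<phi> j q) (frame A \<phi> k q) *
        H q (coframe \<phi> k q) (coframe \<phi> i q))"
      by (intro smooth_fun_on_sum[OF o] smooth_fun_on_mult[OF o] Sym2_dual_smooth[OF B U]
          Sym2_smooth[OF H U]) (auto simp: ij)
    show ?thesis
      by (rule smooth_fun_on_cong[OF o s])
        (simp add: sharp_component[OF H U _ natmap_in[OF B frame(1)[OF U _ ij(2)]]]
          natmap_apply frame(1)[OF U])
  qed
  then show "\<And>t. t \<in> trivs A \<Longrightarrow> case t of (U, r, \<phi>) \<Rightarrow> \<forall>i<r. \<forall>j<r.
        smooth U (\<lambda>q. \<phi> q (sharp A H q (natmap A B q (frame A \<phi> j q))) i)"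
    by auto
qed

section \<open>The inverse of a nondegenerate form\<close>

definition natinv :: "('m \<Rightarrow> 'f \<Rightarrow> 'f \<Rightarrow> real) \<Rightarrow> 'm \<Rightarrow> ('f \<Rightarrow> real) \<Rightarrow> 'f" where
  "natinv B p = inv_into (fibre A p) (natmap A B p)"

lemma natinv:
  assumes "nondegenerate A B" "\<alpha> \<in> dual_fibre A p"
  shows "natinv B p \<alpha> \<in> fibre A p" "natmap A B p (natinv B p \<alpha>) = \<alpha>"
proof -
  have "\<alpha> \<in> natmap A B p ` fibre A p"
    using assms by (simp add: nondegenerate_def bij_betw_def)
  from inv_into_into[OF this] f_inv_into_f[OF this]
  show "natinv B p \<alpha> \<in> fibre A p" "natmap A B p (natinv B p \<alpha>) = \<alpha>"
    by (simp_all add: natinv_def)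
qed

lemma nondegenerate_zeroI:
  assumes B: "B \<in> Sym2_dual A" "nondegenerate A B" and w: "w \<in> fibre A p"
    and "\<And>v. v \<in> fibre A p \<Longrightarrow> B p v w = 0"
  shows "w = 0"
proof (rule inj_onD[of "natmap A B p" "fibre A p"])
  show "inj_on (natmap A B p) (fibre A p)"
    using B(2) by (simp add: nondegenerate_def bij_betw_def)
  show "natmap A B p w = natmap A B p 0"
    using assms(4) Sym2_dual_sym[OF B(1) w] Sym2_dual_sym[OF B(1) fibre_zero]
      fibre_linear_zero[OF Sym2_dual_linear2[OF B(1)]]
    by (simp add: natmap_def fun_eq_iff)
qed (simp_all add: w fibre_zero)

text \<open>The coordinates of the preimage solve a linear system whose matrix is the Gram matrix of
  \<open>B\<close> in the frame. The covector field \<open>\<alpha>\<close> need only live on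
  \<open>U\<close>, so that the coframe can be taken for it.\<close>

lemma natinv_component_smooth:
  assumes B: "B \<in> Sym2_dual A" "nondegenerate A B" and U: "(U, r, \<phi>) \<in> trivs A" "k < r"
    and \<alpha>: "\<And>q. q \<in> U \<Longrightarrow> \<alpha> q \<in> dual_fibre A q" "\<And>j. j < r \<Longrightarrow> smooth U (\<lambda>q. \<alpha> q (frame A \<phi> j q))"
  shows "smooth U (\<lambda>q. \<phi> q (natinv B q (\<alpha> q)) k)"
proof (rule smooth_linear_system_solution[OF triv_open[OF U(1)], where n = r
      and a = "\<lambda>i j q. B q (frame A \<phi> i q) (frame A \<phi> j q)" and d = "\<lambda>i q. \<alpha> q (frame A \<phi> i q)"
      and c = "\<lambda>j q. \<phi> q (natinv B q (\<alpha> q)) j"])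
  note fr = frame(1)[OF U(1)]
  fix q i assume q: "q \<in> U" and i: "i < r"
  let ?w = "natinv B q (\<alpha> q)"
  note w = natinv[OF B(2) \<alpha>(1)[OF q]]
  have "(\<Sum>j<r. B q (frame A \<phi> i q) (frame A \<phi> j q) * \<phi> q ?w j) = B q (frame A \<phi> i q) ?w"
    using fibre_linear_frame[OF U(1) q w(1) Sym2_dual_linear2[OF B(1) fr[OF q i]]]
    by (simp add: mult.commute)
  also have "\<dots> = natmap A B q ?w (frame A \<phi> i q)"
    using Sym2_dual_sym[OF B(1) fr[OF q i] w(1)] fr[OF q i] by (simp add: natmap_apply)
  finally show "(\<Sum>j<r. B q (frame A \<phi> i q) (frame A \<phi> j q) * \<phi> q ?w j) = \<alpha> q (frame A \<phi> i q)"
    using w(2) by simp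
next
  note fr = frame(1)[OF U(1)]
  fix q v assume q: "q \<in> U"
    and v: "\<forall>i<r. (\<Sum>j<r. B q (frame A \<phi> i q) (frame A \<phi> j q) * v j) = 0"
  \<comment> \<open>A solution of the homogeneous system is the coordinate vector of an element
    \<open>B\<close>-orthogonal to the whole fibre, which nondegeneracy forces to be 0.\<close>
  let ?w = "\<Sum>j<r. v j *\<^sub>R frame A \<phi> j q"
  have w: "?w \<in> fibre A q" by (intro fibre_sum fibre_scale fr[OF q]) simp
  have "B q u ?w = 0" if u: "u \<in> fibre A q" for u
  proof -
    have "B q (frame A \<phi> i q) ?w = 0" if "i < r" for i
      using fibre_linear_sum[OF Sym2_dual_linear2[OF B(1) fr[OF q that]], of "{..<r}" "\<lambda>j. frame A \<phi> j q" v]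
        v that fr[OF q] by (simp add: mult.commute)
    then show ?thesis
      using fibre_linear_frame[OF U(1) q u Sym2_dual_linear1[OF B(1) w]] by simp
  qed
  then have "?w = 0" by (rule nondegenerate_zeroI[OF B w])
  moreover have "\<phi> q ?w i = (\<Sum>j<r. v j *\<^sub>R \<phi> q (frame A \<phi> j q) i)" for i
    by (rule fibre_linear_sum[OF fibre_linear_component[OF U(1) q]]) (simp add: fr[OF q])
  ultimately have "(\<Sum>j<r. v j *\<^sub>R \<phi> q (frame A \<phi> j q) i) = 0" for i
    using fibre_linear_zero[OF fibre_linear_component[OF U(1) q]] by simp
  moreover have "(\<Sum>j<r. v j *\<^sub>R \<phi> q (frame A \<phi> j q) i) = (\<Sum>j<r. if j = i then v j else 0)" for i
    by (intro sum.cong) (auto simp: frame(2)[OF U(1) q])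
  ultimately have "(if i < r then v i else 0) = 0" for i by simp
  then show "\<forall>j<r. v j = 0" by metis
qed (use Sym2_dual_smooth[OF B(1) U(1)] \<alpha>(2) U(2) in auto)

lemma natinv_section:
  assumes B: "B \<in> Sym2_dual A" "nondegenerate A B" and \<alpha>: "\<alpha> \<in> dual_sections A"
  shows "app (natinv B) \<alpha> \<in> sections A"
proof (rule sectionsI)
  show "app (natinv B) \<alpha> p \<in> fibre A p" for p
    by (simp add: app_def natinv(1)[OF B(2) dual_sections_fibre[OF \<alpha>]])
  show "smooth U (\<lambda>q. \<phi> q (app (natinv B) \<alpha> q) i)" if U: "(U, r, \<phi>) \<in> trivs A" "i < r" for U r \<phi> i
    unfolding app_def
    by (rule natinv_component_smooth[OF B U dual_sections_fibre[OF \<alpha>] dual_sections_component[OF \<alpha> U(1)]])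
qed

lemma app_natmap_natinv:
  assumes "nondegenerate A B" "\<alpha> \<in> dual_sections A"
  shows "app (natmap A B) (app (natinv B) \<alpha>) = \<alpha>"
  using natinv(2)[OF assms(1) dual_sections_fibre[OF assms(2)]] by (simp add: app_def)

text \<open>If \<open>\<alpha>\<close> and \<open>\<beta>\<close> are the images of \<open>v\<close>
  and \<open>w\<close> under \<open>natmap A B p\<close>, then \<open>H p \<alpha> \<beta>\<close>
  is \<open>B p w (N p v)\<close>, so self-adjointness of \<open>N\<close> is exactly symmetry of
  \<open>H\<close>.\<close>

lemma selfadjoint_Sym2:
  fixes B N
  defines "H \<equiv> \<lambda>p \<alpha> \<beta>. \<beta> (N p (natinv B p \<alpha>))"
  assumes B: "B \<in> Sym2_dual A" "nondegenerate A B" and N: "bundle_map A N"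
    and selfadjoint: "\<And>p v w. v \<in> fibre A p \<Longrightarrow> w \<in> fibre A p \<Longrightarrow> B p (N p v) w = B p v (N p w)"
  shows "H \<in> Sym2 A"
proof -
  have sym: "H p \<alpha> \<beta> = H p \<beta> \<alpha>" if \<alpha>: "\<alpha> \<in> dual_fibre A p" and \<beta>: "\<beta> \<in> dual_fibre A p" for p \<alpha> \<beta>
  proof -
    note v = natinv[OF B(2) \<alpha>] and w = natinv[OF B(2) \<beta>]
    note Nv = bundle_map_in[OF N v(1)] and Nw = bundle_map_in[OF N w(1)]
    have "H p \<alpha> \<beta> = B p (natinv B p \<beta>) (N p (natinv B p \<alpha>))"
      using fun_cong[OF w(2), of "N p (natinv B p \<alpha>)"] Nv by (simp add: H_def natmap_apply)
    also have "\<dots> = B p (natinv B p \<alpha>) (N p (natinv B p \<beta>))"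
      using selfadjoint[OF v(1) w(1)] Sym2_dual_sym[OF B(1) Nv w(1)] by simp
    also have "\<dots> = H p \<beta> \<alpha>"
      using fun_cong[OF v(2), of "N p (natinv B p \<beta>)"] Nw by (simp add: H_def natmap_apply)
    finally show ?thesis .
  qed
  have add: "(\<lambda>v. \<alpha> v + \<beta> v) \<in> dual_fibre A p" if "\<alpha> \<in> dual_fibre A p" "\<beta> \<in> dual_fibre A p" for p \<alpha> \<beta>
    using that by (simp add: dual_fibre_def algebra_simps)
  have scale: "(\<lambda>v. c * \<alpha> v) \<in> dual_fibre A p" if "\<alpha> \<in> dual_fibre A p" for p \<alpha> c
    using that by (simp add: dual_fibre_def algebra_simps)
  have smooth: "smooth U (\<lambda>q. H q (coframe \<phi> i q) (coframe \<phi> j q))"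
    if U: "(U, r, \<phi>) \<in> trivs A" and ij: "i < r" "j < r" for U r \<phi> i j
  proof -
    note o = triv_open[OF U]
    \<comment> \<open>The coefficients of a coframe element in the coframe are constants.\<close>
    have const: "smooth U (\<lambda>q. coframe \<phi> i q (frame A \<phi> k q))" if "k < r" for k
      by (rule smooth_fun_on_cong[OF o smooth_fun_on_const[of _ "if i = k then 1 else 0"]])
        (simp add: coframe_def frame[OF U _ that])
    have "smooth U (\<lambda>q. \<phi> q (natinv B q (coframe \<phi> i q)) k)" if "k < r" for k
      by (rule natinv_component_smooth[OF B U that coframe_in[OF U] const])
    then have s: "smooth U (\<lambda>q. \<Sum>k<r. \<phi> q (natinv B q (coframe \<phi> i q)) k *
        \<phi> q (N q (frame A \<phi> k q)) j)"
      by (intro smooth_fun_on_sum[OF o] smooth_fun_on_mult[OF o] bundle_map_smooth[OF N U ij(2)]) auto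
    show ?thesis
    proof (rule smooth_fun_on_cong[OF o s])
      fix q assume q: "q \<in> U"
      note v = natinv(1)[OF B(2) coframe_in[OF U q, of i]]
      show "(\<Sum>k<r. \<phi> q (natinv B q (coframe \<phi> i q)) k * \<phi> q (N q (frame A \<phi> k q)) j) =
          H q (coframe \<phi> i q) (coframe \<phi> j q)"
        using bundle_map_component[OF N U q v, of j] bundle_map_in[OF N v]
        by (simp add: H_def coframe_def[of \<phi> j])
    qed
  qed
  \<comment> \<open>Linearity in the first argument is transported by symmetry to the second, where
    it is evident from the formula for \<open>H\<close>; thus linearity of the inverse need not be
    established.\<close>
  have "H p (\<lambda>v. \<alpha> v + \<beta> v) \<gamma> = H p \<alpha> \<gamma> + H p \<beta> \<gamma>"
    if "\<alpha> \<in> dual_fibre A p" "\<beta> \<in> dual_fibre A p" "\<gamma> \<in> dual_fibre A p" for p \<alpha> \<beta> \<gamma>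
    unfolding sym[OF add[OF that(1,2)] that(3)] sym[OF that(1,3)] sym[OF that(2,3)] by (simp add: H_def)
  moreover have "H p (\<lambda>v. c * \<alpha> v) \<beta> = c * H p \<alpha> \<beta>"
    if "\<alpha> \<in> dual_fibre A p" "\<beta> \<in> dual_fibre A p" for p \<alpha> \<beta> c
    unfolding sym[OF scale[OF that(1)] that(2)] sym[OF that] by (simp add: H_def)
  ultimately show ?thesis
    unfolding Sym2_def using sym smooth unfolding coframe_def by auto
qed

lemma sharp_of_endomorphism:
  assumes "nondegenerate A B" "bundle_map A N" "\<alpha> \<in> dual_fibre A p"
  shows "sharp A (\<lambda>p \<alpha> \<beta>. \<beta> (N p (natinv B p \<alpha>))) p \<alpha> = N p (natinv B p \<alpha>)"
  by (rule sharp_eqI) (simp_all add: bundle_map_in[OF assms(2)] natinv(1)[OF assms(1,3)])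

end

section \<open>Left-symmetric algebroids\<close>

locale ls_algebroid =
  fixes A :: "('m::{t2_space,second_countable_topology}, 'e::real_inner, 'f::real_vector) algebroid"
  assumes left_symmetric_algebroid: "left_symmetric_algebroid A"

sublocale ls_algebroid \<subseteq> smooth_bundle A
  using left_symmetric_algebroid by unfold_locales (simp add: left_symmetric_algebroid_def)

context ls_algebroid
begin

lemma anchor_map: "anchor_map A"
  using left_symmetric_algebroid by (simp add: left_symmetric_algebroid_def)

lemma anchor_linear: "fibre_linear p (\<lambda>v. anchor A p v f)"
  using anchor_map by (simp add: anchor_map_def fibre_linear_def)

lemma anchor_smooth:
  assumes "(U, r, \<phi>) \<in> trivs A" "j < r" "f \<in> smooth_functions A"
  shows "smooth U (\<lambda>q. anchor A q (frame A \<phi> j q) f)"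
proof -
  have "\<forall>(U, r, \<phi>)\<in>trivs A. \<forall>j<r. \<forall>f\<in>smooth_functions A.
      smooth U (\<lambda>q. anchor A q (frame A \<phi> j q) f)"
    using anchor_map by (simp add: anchor_map_def)
  from bspec[OF this assms(1)] assms(2,3) show ?thesis by simp
qed

lemma act_smooth:
  assumes x: "x \<in> sections A" and f: "f \<in> smooth_functions A"
  shows "act A x f \<in> smooth_functions A"
proof (rule smooth_functionsI)
  fix U r \<phi> assume U: "(U, r, \<phi>) \<in> trivs A"
  note o = triv_open[OF U]
  have s: "smooth U (\<lambda>q. \<Sum>j<r. \<phi> q (x q) j * anchor A q (frame A \<phi> j q) f)"
    by (intro smooth_fun_on_sum[OF o] smooth_fun_on_mult[OF o] sections_component[OF x U]
        anchor_smooth[OF U _ f]) auto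
  show "smooth U (act A x f)"
    by (rule smooth_fun_on_cong[OF o s])
      (simp add: act_def fibre_linear_frame[OF U _ sections_fibre[OF x] anchor_linear])
qed

lemma act_tangent: "x \<in> sections A \<Longrightarrow> anchor A p (x p) \<in> tangent_space A p"
  using anchor_map sections_fibre by (simp add: anchor_map_def)

lemma act_add:
  "x \<in> sections A \<Longrightarrow> f \<in> smooth_functions A \<Longrightarrow> g \<in> smooth_functions A \<Longrightarrow>
     act A x (\<lambda>q. f q + g q) p = act A x f p + act A x g p"
  using act_tangent[of x p] by (simp add: act_def tangent_space_def)

lemma act_mult:
  "x \<in> sections A \<Longrightarrow> f \<in> smooth_functions A \<Longrightarrow> g \<in> smooth_functions A \<Longrightarrow>
     act A x (\<lambda>q. f q * g q) p = f p * act A x g p + act A x f p * g p"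
  using act_tangent[of x p] by (simp add: act_def tangent_space_def)

lemma act_section_add:
  "x \<in> sections A \<Longrightarrow> y \<in> sections A \<Longrightarrow> act A (\<lambda>q. x q + y q) f p = act A x f p + act A y f p"
  using fibre_linear_add[OF anchor_linear] by (simp add: act_def sections_fibre)

lemma act_section_scale:
  "x \<in> sections A \<Longrightarrow> act A (\<lambda>q. g q *\<^sub>R x q) f p = g p * act A x f p"
  using fibre_linear_scale[OF anchor_linear] by (simp add: act_def sections_fibre)

lemma mul_section: "x \<in> sections A \<Longrightarrow> y \<in> sections A \<Longrightarrow> mul A x y \<in> sections A"
  using left_symmetric_algebroid by (simp add: left_symmetric_algebroid_def)

lemma mul_add:
  assumes "x \<in> sections A" "y \<in> sections A" "z \<in> sections A"
  shows "mul A (\<lambda>q. x q + y q) z p = mul A x z p + mul A y z p"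
    "mul A z (\<lambda>q. x q + y q) p = mul A z x p + mul A z y p"
  using left_symmetric_algebroid assms by (simp_all add: left_symmetric_algebroid_def)

lemma mul_scale:
  assumes "x \<in> sections A" "y \<in> sections A" "f \<in> smooth_functions A"
  shows "mul A x (\<lambda>q. f q *\<^sub>R y q) p = f p *\<^sub>R mul A x y p + act A x f p *\<^sub>R y p"
    "mul A (\<lambda>q. f q *\<^sub>R x q) y p = f p *\<^sub>R mul A x y p"
  using left_symmetric_algebroid assms by (simp_all add: left_symmetric_algebroid_def)

lemma bracket_section: "x \<in> sections A \<Longrightarrow> y \<in> sections A \<Longrightarrow> bracket A x y \<in> sections A"
  unfolding bracket_def by (intro sections_diff mul_section)

section \<open>The operators that make up the product on the dual bundle\<close>

lemma pair_add:
  "\<alpha> \<in> dual_sections A \<Longrightarrow> x \<in> sections A \<Longrightarrow> y \<in> sections A \<Longrightarrow>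
     pair \<alpha> (\<lambda>q. x q + y q) = (\<lambda>p. pair \<alpha> x p + pair \<alpha> y p)"
  by (simp add: pair_def fibre_linear_add[OF dual_sections_linear] sections_fibre)

lemma pair_scale:
  "\<alpha> \<in> dual_sections A \<Longrightarrow> x \<in> sections A \<Longrightarrow> pair \<alpha> (\<lambda>q. f q *\<^sub>R x q) = (\<lambda>p. f p * pair \<alpha> x p)"
  by (simp add: pair_def fibre_linear_scale[OF dual_sections_linear] sections_fibre)

text \<open>Replacing \<open>y\<close> by \<open>f\<close> times \<open>y\<close> produces the term
  \<open>act A x f p * pair \<alpha> y p\<close> twice, from the derivative of the pairing and from
  the bracket, with opposite signs.\<close>

lemma tensorial_lie_derivative:
  assumes x: "x \<in> sections A" and \<alpha>: "\<alpha> \<in> dual_sections A"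
  shows "tensorial (\<lambda>y p. act A x (pair \<alpha> y) p - pair \<alpha> (bracket A x y) p)"
proof (rule tensorialI)
  fix y assume y: "y \<in> sections A"
  show "(\<lambda>p. act A x (pair \<alpha> y) p - pair \<alpha> (bracket A x y) p) \<in> smooth_functions A"
    by (intro smooth_functions_diff act_smooth pair_smooth bracket_section x y \<alpha>)
  { fix z p assume z: "z \<in> sections A"
    have "bracket A x (\<lambda>q. y q + z q) = (\<lambda>p. bracket A x y p + bracket A x z p)"
      using mul_add[OF y z x] by (simp add: bracket_def fun_eq_iff)
    then show "act A x (pair \<alpha> (\<lambda>q. y q + z q)) p - pair \<alpha> (bracket A x (\<lambda>q. y q + z q)) p =
        act A x (pair \<alpha> y) p - pair \<alpha> (bracket A x y) p +
        (act A x (pair \<alpha> z) p - pair \<alpha> (bracket A x z) p)"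
      using x y z \<alpha> by (simp add: pair_add act_add pair_smooth bracket_section) }
  fix f p assume f: "f \<in> smooth_functions A"
  have "bracket A x (\<lambda>q. f q *\<^sub>R y q) = (\<lambda>p. f p *\<^sub>R bracket A x y p + act A x f p *\<^sub>R y p)"
    using mul_scale[OF x y f] mul_scale[OF y x f] by (simp add: bracket_def fun_eq_iff algebra_simps)
  then show "act A x (pair \<alpha> (\<lambda>q. f q *\<^sub>R y q)) p - pair \<alpha> (bracket A x (\<lambda>q. f q *\<^sub>R y q)) p =
      f p * (act A x (pair \<alpha> y) p - pair \<alpha> (bracket A x y) p)"
    using x y f \<alpha>
    by (simp add: pair_add pair_scale act_mult pair_smooth bracket_section sections_scale act_smooth
        algebra_simps)
qed

lemma tensorial_dual_right_mult:
  assumes x: "x \<in> sections A" and \<alpha>: "\<alpha> \<in> dual_sections A"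
  shows "tensorial (\<lambda>y p. - pair \<alpha> (mul A y x) p)"
proof (rule tensorialI)
  fix y assume y: "y \<in> sections A"
  show "(\<lambda>p. - pair \<alpha> (mul A y x) p) \<in> smooth_functions A"
    by (intro smooth_functions_uminus pair_smooth mul_section x y \<alpha>)
  { fix z p assume z: "z \<in> sections A"
    have "mul A (\<lambda>q. y q + z q) x = (\<lambda>p. mul A y x p + mul A z x p)"
      using mul_add[OF y z x] by (simp add: fun_eq_iff)
    then show "- pair \<alpha> (mul A (\<lambda>q. y q + z q) x) p = - pair \<alpha> (mul A y x) p + - pair \<alpha> (mul A z x) p"
      using x y z \<alpha> by (simp add: pair_add mul_section) }
  fix f p assume f: "f \<in> smooth_functions A"
  have "mul A (\<lambda>q. f q *\<^sub>R y q) x = (\<lambda>p. f p *\<^sub>R mul A y x p)"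
    using mul_scale[OF y x f] by (simp add: fun_eq_iff)
  then show "- pair \<alpha> (mul A (\<lambda>q. f q *\<^sub>R y q) x) p = f p * - pair \<alpha> (mul A y x) p"
    using x y \<alpha> by (simp add: pair_scale mul_section)
qed

lemma tensorial_differential:
  assumes "f \<in> smooth_functions A"
  shows "tensorial (\<lambda>x. act A x f)"
  by (rule tensorialI) (simp_all add: act_smooth assms act_section_add act_section_scale)

text \<open>Turns the definite descriptions inside \<open>dual_mul\<close> into a formula; all later
  use of the product goes through it. The third term is positive since the right multiplication on
  covectors carries a sign of its own.\<close>

lemma pair_dual_mul:
  assumes H: "H \<in> Sym2 A" and \<alpha>: "\<alpha> \<in> dual_sections A" and \<beta>: "\<beta> \<in> dual_sections A"
    and y: "y \<in> sections A"
  shows "pair (dual_mul A H \<alpha> \<beta>) y p =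
     act A (app (sharp A H) \<alpha>) (pair \<beta> y) p - pair \<beta> (bracket A (app (sharp A H) \<alpha>) y) p
     + pair \<alpha> (mul A y (app (sharp A H) \<beta>)) p - act A y (pair \<beta> (app (sharp A H) \<alpha>)) p"
proof -
  note h = sharp_section[OF H \<alpha>] sharp_section[OF H \<beta>]
  have "pair (lie_derivative A (app (sharp A H) \<alpha>) \<beta>) y p =
      act A (app (sharp A H) \<alpha>) (pair \<beta> y) p - pair \<beta> (bracket A (app (sharp A H) \<alpha>) y) p"
    unfolding lie_derivative_def by (rule dual_section_of(2)[OF tensorial_lie_derivative[OF h(1) \<beta>] y])
  moreover have "pair (dual_right_mult A (app (sharp A H) \<beta>) \<alpha>) y p =
      - pair \<alpha> (mul A y (app (sharp A H) \<beta>)) p"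
    unfolding dual_right_mult_def
    by (rule dual_section_of(2)[OF tensorial_dual_right_mult[OF h(2) \<alpha>] y])
  moreover have "pair (differential A (ev H \<alpha> \<beta>)) y p = act A y (pair \<beta> (app (sharp A H) \<alpha>)) p"
    unfolding differential_def ev_sharp[OF H \<alpha> \<beta>]
    by (rule dual_section_of(2)[OF tensorial_differential[OF pair_smooth[OF \<beta> h(1)]] y])
  ultimately show ?thesis by (simp add: pair_def dual_mul_def)
qed

section \<open>Cocycles, self-adjoint endomorphisms and the two identities\<close>

lemma ev_sym: "B \<in> Sym2_dual A \<Longrightarrow> x \<in> sections A \<Longrightarrow> y \<in> sections A \<Longrightarrow> ev B x y = ev B y x"
  by (simp add: ev_def fun_eq_iff Sym2_dual_sym sections_fibre)

lemma ev_bracket: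
  assumes B: "B \<in> Sym2_dual A" and x: "x \<in> sections A" "y \<in> sections A" and z: "z \<in> sections A"
  shows "ev B (bracket A x y) z p = ev B (mul A x y) z p - ev B (mul A y x) z p"
    "ev B z (bracket A x y) p = ev B z (mul A x y) p - ev B z (mul A y x) p"
  using x z fibre_linear_diff[OF Sym2_dual_linear1[OF B sections_fibre[OF z]]]
    fibre_linear_diff[OF Sym2_dual_linear2[OF B sections_fibre[OF z]]]
  by (simp_all add: ev_def bracket_def mul_section sections_fibre)

end

text \<open>The common setting of both directions: \<open>N\<close> and \<open>H\<close> determine
  each other through \<open>sharp_natmap\<close> when \<open>B\<close> is nondegenerate.
  Self-adjointness of \<open>N\<close> is derived from the symmetry of \<open>H\<close>.\<close>

locale selfadjoint_endomorphism = ls_algebroid A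
  for A :: "('m::{t2_space,second_countable_topology}, 'e::real_inner, 'f::real_vector) algebroid" +
  fixes B :: "'m \<Rightarrow> 'f \<Rightarrow> 'f \<Rightarrow> real" and N :: "'m \<Rightarrow> 'f \<Rightarrow> 'f"
    and H :: "'m \<Rightarrow> ('f \<Rightarrow> real) \<Rightarrow> ('f \<Rightarrow> real) \<Rightarrow> real"
  assumes cocycle: "two_cocycle A B"
    and N: "bundle_map A N"
    and H: "H \<in> Sym2 A"
    and sharp_natmap: "v \<in> fibre A p \<Longrightarrow> sharp A H p (natmap A B p v) = N p v"
begin

lemma B: "B \<in> Sym2_dual A"
  using cocycle by (simp add: two_cocycle_def)

lemma coboundary_zero:
  "x \<in> sections A \<Longrightarrow> y \<in> sections A \<Longrightarrow> z \<in> sections A \<Longrightarrow> coboundary A B x y z p = 0"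
  using cocycle by (simp add: two_cocycle_def)

lemma app_sharp_natmap: "x \<in> sections A \<Longrightarrow> app (sharp A H) (app (natmap A B) x) = app N x"
  by (simp add: app_def sharp_natmap sections_fibre)

text \<open>The two sides are the values of \<open>H\<close> on the covectors of \<open>x\<close>
  and \<open>y\<close>, taken in either order.\<close>

lemma ev_selfadjoint:
  assumes x: "x \<in> sections A" and y: "y \<in> sections A"
  shows "ev B x (app N y) = ev B (app N x) y"
proof -
  note b = natmap_section[OF B x] natmap_section[OF B y]
  have "ev H (app (natmap A B) y) (app (natmap A B) x) = ev H (app (natmap A B) x) (app (natmap A B) y)"
    using b by (simp add: ev_def fun_eq_iff Sym2_sym[OF H] dual_sections_fibre)
  then show ?thesis
    unfolding ev_sharp[OF H b] ev_sharp[OF H b(2) b(1)] app_sharp_natmap[OF x] app_sharp_natmap[OF y]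
    by (simp add: pair_natmap bundle_map_section[OF N] x y ev_sym[OF B, of y "app N x"])
qed

lemma ev_twist: "ev (\<lambda>q v w. B q (N q v) w) x y = ev B (app N x) y"
  by (simp add: ev_def app_def)

text \<open>By \<open>pair_dual_mul\<close> the left side becomes a sum of derivatives of
  \<open>B\<close> and of \<open>B\<close> on products with one \<open>N\<close> inserted. The
  derivatives along \<open>z\<close> cancel, since \<open>B(y, N x) = B(x, N y)\<close>.\<close>

lemma dual_kv_bracket_eq_coboundary:
  assumes x: "x \<in> sections A" and y: "y \<in> sections A" and z: "z \<in> sections A"
  shows "dual_kv_bracket A H B x y z p = coboundary A (\<lambda>q v w. B q (N q v) w) x y z p"
proof -
  note s = x y z bundle_map_section[OF N x] bundle_map_section[OF N y] bundle_map_section[OF N z]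
  note b = natmap_section[OF B x] natmap_section[OF B y] natmap_section[OF B z]
  \<comment> \<open>Symmetry of \<open>B\<close> and self-adjointness of \<open>N\<close> fix one
    representative for each form of two arguments, which makes the derivative terms
    comparable.\<close>
  have sym: "ev B y x = ev B x y" "ev B z x = ev B x z" "ev B z y = ev B y z"
    "ev B (app N y) x = ev B (app N x) y" "ev B (app N z) x = ev B (app N x) z"
    "ev B (app N z) y = ev B (app N y) z"
    using ev_sym[OF B] ev_selfadjoint s by metis+
  have mul_sym: "ev B (mul A u v) w = ev B w (mul A u v)"
    if "u \<in> sections A" "v \<in> sections A" "w \<in> sections A" for u v w
    by (rule ev_sym[OF B mul_section[OF that(1,2)] that(3)])
  have pair_diff: "pair (\<lambda>q v. \<theta> q v - \<theta>' q v) u p = pair \<theta> u p - pair \<theta>' u p"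
    for \<theta> \<theta>' :: "'m \<Rightarrow> 'f \<Rightarrow> real" and u
    by (simp add: pair_def)
  \<comment> \<open>The cocycle conditions at \<open>(N x, y, z)\<close>, \<open>(x, N y, z)\<close>
    and \<open>(x, y, N z)\<close>, added to the left side, give the right side.\<close>
  from coboundary_zero[OF s(4) s(2) s(3), of p] coboundary_zero[OF s(1) s(5) s(3), of p]
      coboundary_zero[OF s(1) s(2) s(6), of p]
  show ?thesis
    unfolding dual_kv_bracket_def Let_def coboundary_def ev_twist pair_diff
    by (simp add: pair_dual_mul[OF H] b s app_sharp_natmap pair_natmap mul_section bracket_section
        mul_sym ev_bracket[OF B] ev_selfadjoint sym bundle_map_section[OF N])
qed

text \<open>The second argument of the coboundary is \<open>N y\<close> because the bracket of
  \<open>H\<close> already differentiates along \<open>N x\<close> and \<open>N y\<close>. All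
  derivatives and brackets cancel; the remaining products are paired with \<open>y\<close>,
  \<open>N y\<close> and \<open>N (N y)\<close>, and self-adjointness gathers them into a pairing
  with \<open>y\<close>.\<close>

lemma kv_bracket_plus_coboundary:
  assumes x: "x \<in> sections A" and y: "y \<in> sections A" and z: "z \<in> sections A"
  shows "kv_bracket A H (app (natmap A B) x) (app (natmap A B) y) (app (natmap A B) z) p
      + coboundary A (\<lambda>q v w. B q (N q v) w) x (app N y) z p =
    ev B y (\<lambda>p. app N (\<lambda>p. mul A x (app N z) p + mul A (app N x) z p - app N (mul A x z) p) p
      - mul A (app N x) (app N z) p) p"
proof -
  note Nx = bundle_map_section[OF N x] and Ny = bundle_map_section[OF N y]
    and Nz = bundle_map_section[OF N z]
  note s = x y z Nx Ny Nz bundle_map_section[OF N Ny]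
  note b = natmap_section[OF B x] natmap_section[OF B y] natmap_section[OF B z]
  let ?S = "\<lambda>p. mul A x (app N z) p + mul A (app N x) z p - app N (mul A x z) p"
  have xz: "app N (mul A x z) \<in> sections A"
    by (intro bundle_map_section[OF N] mul_section x z)
  have S: "?S \<in> sections A"
    by (intro sections_diff sections_add mul_section xz s)
  have "ev B y (\<lambda>p. app N ?S p - mul A (app N x) (app N z) p) p =
      ev B y (app N ?S) p - ev B y (mul A (app N x) (app N z)) p"
    using fibre_linear_diff[OF Sym2_dual_linear2[OF B sections_fibre[OF y]]]
    by (simp add: ev_def sections_fibre bundle_map_section[OF N S] mul_section s)
  also have "ev B y (app N ?S) p = ev B (app N y) ?S p"
    by (simp add: ev_selfadjoint[OF y S])
  also have "\<dots> = ev B (app N y) (mul A x (app N z)) p + ev B (app N y) (mul A (app N x) z) p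
      - ev B (app N (app N y)) (mul A x z) p"
    using fibre_linear_diff[OF Sym2_dual_linear2[OF B sections_fibre[OF Ny]]]
      fibre_linear_add[OF Sym2_dual_linear2[OF B sections_fibre[OF Ny]]]
      fun_cong[OF ev_selfadjoint[OF Ny mul_section[OF x z]], of p]
    by (simp add: ev_def sections_fibre sections_fibre[OF xz] mul_section s fibre_add)
  finally have rhs: "ev B y (\<lambda>p. app N ?S p - mul A (app N x) (app N z) p) p =
      ev B (app N y) (mul A x (app N z)) p + ev B (app N y) (mul A (app N x) z) p
      - ev B (app N (app N y)) (mul A x z) p - ev B y (mul A (app N x) (app N z)) p" .
  have sym: "ev B z (app N y) = ev B (app N y) z" "ev B z (app N x) = ev B (app N x) z"
    "ev B z (bracket A (app N x) (app N y)) = ev B (bracket A (app N x) (app N y)) z"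
    by (intro ev_sym[OF B] bracket_section s)+
  \<comment> \<open>\<open>N\<close> is moved to the first argument, the form in which it occurs in
    \<open>B\<^sub>N\<close>.\<close>
  have twist: "ev B (app N y) (app N z) = ev B (app N (app N y)) z"
    "ev B x (app N z) = ev B (app N x) z"
    "ev B (bracket A x (app N y)) (app N z) = ev B (app N (bracket A x (app N y))) z"
    by (intro ev_selfadjoint bracket_section s)+
  \<comment> \<open>Subtracting the cocycle conditions at \<open>(N x, N y, z)\<close> and
    \<open>(x, N y, N z)\<close> leaves the four terms of \<open>rhs\<close>.\<close>
  show ?thesis
    using coboundary_zero[OF Nx Ny z, of p] coboundary_zero[OF x Ny Nz, of p]
    unfolding rhs kv_bracket_def Let_def coboundary_def ev_twist
      app_sharp_natmap[OF x] app_sharp_natmap[OF y] app_sharp_natmap[OF z] twist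
    by (simp add: pair_natmap mul_section bracket_section s sym)
qed

end

text \<open>A section passes through every vector, so vanishing against all sections
  \<open>y\<close> means vanishing against the whole fibre, and nondegeneracy applies.\<close>

lemma (in ls_algebroid) nijenhuis_iff_torsion_zero:
  assumes "nondegenerate A B" "B \<in> Sym2_dual A" "bundle_map A N"
  shows "nijenhuis_operator A N \<longleftrightarrow> (\<forall>x\<in>sections A. \<forall>y\<in>sections A. \<forall>z\<in>sections A. \<forall>p.
    ev B y (\<lambda>p. app N (\<lambda>p. mul A x (app N z) p + mul A (app N x) z p - app N (mul A x z) p) p
      - mul A (app N x) (app N z) p) p = 0)" (is "_ \<longleftrightarrow> ?R")
proof
  assume "nijenhuis_operator A N"
  then show ?R
    using fibre_linear_zero[OF Sym2_dual_linear2[OF assms(2)]]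
    by (simp add: nijenhuis_operator_def ev_def sections_fibre)
next
  assume R: ?R
  have "mul A (app N x) (app N z) =
      app N (\<lambda>p. mul A x (app N z) p + mul A (app N x) z p - app N (mul A x z) p)"
    if x: "x \<in> sections A" and z: "z \<in> sections A" for x z
  proof
    fix p
    note N = bundle_map_section[OF assms(3)]
    let ?S = "\<lambda>p. mul A x (app N z) p + mul A (app N x) z p - app N (mul A x z) p"
    let ?T = "\<lambda>p. app N ?S p - mul A (app N x) (app N z) p"
    have "?T \<in> sections A"
      by (intro sections_diff sections_add N mul_section x z)
    moreover have "B p v (?T p) = 0" if v: "v \<in> fibre A p" for v
    proof -
      obtain y where "y \<in> sections A" "y p = v" by (rule section_through[OF v])
      then show ?thesis using R x z by (auto simp: ev_def)
    qed
    ultimately have "?T p = 0"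
      using nondegenerate_zeroI[OF assms(2,1) sections_fibre, of ?T p] by simp
    then show "mul A (app N x) (app N z) p = app N ?S p" by simp
  qed
  then show "nijenhuis_operator A N"
    using assms(3) by (simp add: nijenhuis_operator_def)
qed

context selfadjoint_endomorphism
begin

lemma complementary_iff:
  "complementary A H B \<longleftrightarrow> (\<forall>x\<in>sections A. \<forall>y\<in>sections A. \<forall>z\<in>sections A. \<forall>p.
     coboundary A (\<lambda>q v w. B q (N q v) w) x y z p = 0)"
  using B by (simp add: complementary_def dual_kv_bracket_eq_coboundary)

text \<open>Nondegeneracy enters twice: every section of the dual bundle comes from a section of the
  bundle, by smoothness of the inverse, and the torsion is detected by its pairings.\<close>

lemma koszul_vinberg_iff:
  assumes "nondegenerate A B" "complementary A H B"
  shows "koszul_vinberg A H \<longleftrightarrow> nijenhuis_operator A N"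
proof -
  have "koszul_vinberg A H \<longleftrightarrow> (\<forall>x\<in>sections A. \<forall>y\<in>sections A. \<forall>z\<in>sections A. \<forall>p.
      kv_bracket A H (app (natmap A B) x) (app (natmap A B) y) (app (natmap A B) z) p = 0)"
    (is "_ \<longleftrightarrow> ?R")
  proof
    assume "koszul_vinberg A H"
    then show ?R by (simp add: koszul_vinberg_def natmap_section[OF B])
  next
    assume R: ?R
    have "kv_bracket A H \<alpha> \<beta> \<gamma> p = 0"
      if "\<alpha> \<in> dual_sections A" "\<beta> \<in> dual_sections A" "\<gamma> \<in> dual_sections A" for \<alpha> \<beta> \<gamma> p
      using R[rule_format, OF that[THEN natinv_section[OF B assms(1)]]]
      by (simp add: app_natmap_natinv[OF assms(1)] that)
    then show "koszul_vinberg A H" using H by (simp add: koszul_vinberg_def)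
  qed
  \<comment> \<open>Complementarity, applied at \<open>(x, N y, z)\<close>, removes the coboundary
    from the second identity, so the bracket of \<open>H\<close> equals the paired torsion.\<close>
  also have "\<dots> \<longleftrightarrow> nijenhuis_operator A N"
    using assms(2) kv_bracket_plus_coboundary
    unfolding nijenhuis_iff_torsion_zero[OF assms(1) B N] complementary_iff
    by (simp add: bundle_map_section[OF N])
  finally show ?thesis .
qed

text \<open>The closedness of \<open>B\<^sub>N\<close> is complementarity, and given that, the
  Nijenhuis condition is the Koszul-Vinberg condition. Each half of the theorem is one
  direction.\<close>

lemma pseudo_hessian_nijenhuis_iff:
  assumes "nondegenerate A B"
  shows "pseudo_hessian_nijenhuis A B N \<longleftrightarrow> koszul_vinberg A H \<and> complementary A H B"
  using cocycle ev_selfadjoint koszul_vinberg_iff[OF assms]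
  by (auto simp: pseudo_hessian_nijenhuis_def complementary_iff)

end

theorem proposition6p8:
  fixes A :: "('m::{t2_space,second_countable_topology}, 'e::real_inner, 'f::real_vector) algebroid"
  assumes "left_symmetric_algebroid A"
  shows "(\<forall>B H. B \<in> Sym2_dual A \<and> nondegenerate A B \<and> two_cocycle A B \<and>
              koszul_vinberg A H \<and> complementary A H B
            \<longrightarrow> pseudo_hessian_nijenhuis A B (\<lambda>p v. sharp A H p (natmap A B p v))) \<and>
         (\<forall>B N. pseudo_hessian_nijenhuis A B N \<and> nondegenerate A B
            \<longrightarrow> (\<exists>H. (\<forall>p. \<forall>\<alpha>\<in>dual_fibre A p.
                         sharp A H p \<alpha> = N p (inv_into (fibre A p) (natmap A B p) \<alpha>)) \<and>
                     koszul_vinberg A H \<and> two_cocycle A B \<and> complementary A H B))"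
proof (intro conjI allI impI; elim conjE)
  interpret ls_algebroid A by unfold_locales (rule assms)
  fix B H
  assume *: "B \<in> Sym2_dual A" "nondegenerate A B" "two_cocycle A B"
    "koszul_vinberg A H" "complementary A H B"
  then have H: "H \<in> Sym2 A" by (simp add: koszul_vinberg_def)
  interpret selfadjoint_endomorphism A B "\<lambda>p v. sharp A H p (natmap A B p v)" H
    by unfold_locales (simp_all add: * H sharp_natmap_bundle_map)
  show "pseudo_hessian_nijenhuis A B (\<lambda>p v. sharp A H p (natmap A B p v))"
    using pseudo_hessian_nijenhuis_iff * by simp
next
  interpret ls_algebroid A by unfold_locales (rule assms)
  fix B N
  assume hn: "pseudo_hessian_nijenhuis A B N" and nondegenerate: "nondegenerate A B"
  then have B: "B \<in> Sym2_dual A" "two_cocycle A B" and N: "bundle_map A N"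
    by (simp_all add: pseudo_hessian_nijenhuis_def two_cocycle_def nijenhuis_operator_def)
  \<comment> \<open>The hypothesis speaks of sections, while symmetry of the tensor to be
    constructed is a condition on fibres.\<close>
  have selfadjoint: "B p (N p v) w = B p v (N p w)" if v: "v \<in> fibre A p" and w: "w \<in> fibre A p" for p v w
  proof -
    obtain x where x: "x \<in> sections A" "x p = v" by (rule section_through[OF v])
    obtain y where y: "y \<in> sections A" "y p = w" by (rule section_through[OF w])
    have "ev B (app N x) y p = ev B x (app N y) p"
      using hn x(1) y(1) by (simp add: pseudo_hessian_nijenhuis_def)
    then show ?thesis using x(2) y(2) by (simp add: ev_def app_def)
  qed
  \<comment> \<open>The only possible choice on covectors: pairing the prescribed map
    \<open>N \<circ> b\<inverse>\<close> on \<open>\<alpha>\<close> with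
    \<open>\<beta>\<close>.\<close>
  let ?H = "\<lambda>p \<alpha> \<beta>. \<beta> (N p (natinv B p \<alpha>))"
  note sharp_H = sharp_of_endomorphism[OF nondegenerate N]
  interpret selfadjoint_endomorphism A B N ?H
  proof unfold_locales
    show "?H \<in> Sym2 A"
      using selfadjoint by (intro selfadjoint_Sym2[OF B(1) nondegenerate N]) assumption
    show "sharp A ?H p (natmap A B p v) = N p v" if v: "v \<in> fibre A p" for p v
    proof -
      have "natinv B p (natmap A B p v) = v"
        using nondegenerate v unfolding natinv_def nondegenerate_def
        by (intro inv_into_f_f) (auto simp: bij_betw_def)
      then show ?thesis using sharp_H[OF natmap_in[OF B(1) v]] by simp
    qed
  qed (simp_all add: B N)
  show "\<exists>H. (\<forall>p. \<forall>\<alpha>\<in>dual_fibre A p.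
        sharp A H p \<alpha> = N p (inv_into (fibre A p) (natmap A B p) \<alpha>)) \<and>
      koszul_vinberg A H \<and> two_cocycle A B \<and> complementary A H B"
    using sharp_H pseudo_hessian_nijenhuis_iff[OF nondegenerate] hn cocycle
    by (intro exI[of _ ?H]) (simp add: natinv_def)
qed

end
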